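(* Let $p$ be an odd prime, $k\ge2$, $3\le s<k+2$, $r=k+s$, and $0\le l<p^k$. The $p^{(k)}$-Fibonacci number $\mathcal M_{s,k}(l)=\mathcal M\big(\lambda(2r;(x_{(2s,k)},x_{(s,k)}+l))\big)$ is given as follows (empty sums are $0$). (a) If $l=0$, then $\mathcal M_{s,k}(l)=\frac{p-1}{2}\big(2(s-1)p^{s-1}+1\big)$. (b) For $1\le t\le\frac{p-3}{2}$: (i) if $s\ne3$, $0\le i\le s-4$ and $(t-1)\sum_{\iota=i}^{k-1}p^\iota+p^i\le l\le(t-1)\sum_{\iota=i+1}^{k-1}p^\iota+p^{i+1}-1$, then $$\mathcal M_{s,k}(l)=\tfrac{p-1}{2}\Big(2(s-1)p^{s-1}+1+2t\sum_{j=0}^{s-3}p^j-2\sum_{\mu=0}^{s-i-4}p^\mu\Big);$$ (ii) if $(t-1)\sum_{\iota=s-3}^{k-1}p^\iota+p^{s-3}\le l\le t\sum_{\iota=0}^{k-1}p^\iota$, then $$\mathcal M_{s,k}(l)=\tfrac{p-1}{2}\Big(2(s-1)p^{s-1}+1+2t\sum_{j=0}^{s-3}p^j\Big).$$ (c) (The case $t=\frac{p-1}{2}$.) (i) If $s\ne3$, $0\le i\le s-4$ and $\frac{p-3}{2}\sum_{\iota=i}^{k-1}p^\iota+p^i\le l\le\frac{p-3}{2}\sum_{\iota=i+1}^{k-1}p^\iota+p^{i+1}-1$, then $$\mathcal M_{s,k}(l)=\tfrac{p-1}{2}\Big(2(s-1)p^{s-1}+1+(p-1)\sum_{j=0}^{s-3}p^j-2\sum_{\mu=0}^{s-i-4}p^\mu\Big);$$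 (ii) if $\frac{p-3}{2}\sum_{\iota=s-3}^{k-1}p^\iota+p^{s-3}\le l\le\frac{p-1}{2}\sum_{\iota=s-2}^{k-1}p^\iota-1$, then $$\mathcal M_{s,k}(l)=\tfrac{p-1}{2}\big(2(s-1)p^{s-1}+1+p^{s-2}-1\big);$$ (iii) if $1\le i'\le s-2$ and $\frac{p-1}{2}\sum_{\iota=i'}^{k-1}p^\iota\le l\le\frac{p-1}{2}\sum_{\iota=i'-1}^{k-1}p^\iota-1$, then $$\mathcal M_{s,k}(l)=\tfrac{p-1}{2}\Big(2(s-1)p^{s-1}-1-p^{s-2}-2\sum_{\theta=1}^{s-3}p^\theta+2\sum_{\mu=s-i'-1}^{s-2}p^\mu-1\Big);$$ (iv) if $l=\frac{p-1}{2}\sum_{\iota=0}^{k-1}p^\iota$, then $$\mathcal M_{s,k}(l)=\tfrac{p-1}{2}\Big(2(s-1)p^{s-1}-1-p^{s-2}-2\sum_{\theta=1}^{s-3}p^\theta-1\Big).$$ (d) For $\frac{p+1}{2}\le t\le p-1$: (i) if $s\ne3$, $0\le i\le s-4$ and $(t-1)\sum_{\iota=i}^{k-1}p^\iota+p^i\le l\le(t-1)\sum_{\iota=i+1}^{k-1}p^\iota+p^{i+1}-1$, then $$\mathcal M_{s,k}(l)=\tfrac{p-1}{2}\Big(2(s-1)p^{s-1}-1+(2t-2p)\sum_{j=0}^{s-3}p^j-2\sum_{\mu=0}^{s-i-4}p^\mu\Big);$$ (ii) if $(t-1)\sum_{\iota=s-3}^{k-1}p^\iota+p^{s-3}\le l\le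 t\sum_{\iota=0}^{k-1}p^\iota$, then $$\mathcal M_{s,k}(l)=\tfrac{p-1}{2}\Big(2(s-1)p^{s-1}-1+(2t-2p)\sum_{j=0}^{s-3}p^j\Big).$$
   Context: Notation: $p$ is an odd prime, $k\ge0$, $r\ge1$ integers with $s=r-k\ge1$, $0\le l<p^k$; $x_{(a,k)}=p^k(ap-(a+1))$ for $a\ge1$. $\lambda(c;(n,i))$ denotes the hook partition $(n-i,1^i)$ of $n$, regarded as a vertex on floor $c$ of the $p$-Bratteli diagram. Paths. $P^{2r}_l$ is the set of all downward paths in the diagram from $\lambda(2r;(x_{(2s,k)},x_{(s,k)}+l))$ to floor $1$. Along a path, blocks $B(i;(m_i,n_i))$ ($m_i$ horizontal nodes and $n_i$ vertical nodes) are removed for $i=2r-1,2r-2,\dots,1$. Explicitly, a path $P$ is determined by arbitrary integers $u_s,u_{s-1},\dots,u_2\in\{0,\dots,p-1\}$ and $u_1\in\{0,\dots,p-2\}$ (distinct choices give distinct paths, and all paths arise). Put $L_s=l$ and, for $j=s,s-1,\dots,2$, $L'_j=L_j+p^ku_j$ and $L_{j-1}=\lfloor L'_j/p\rfloor$. The path visits $\lambda(2(k+j);(x_{(2j,k)},x_{(j,k)}+L_j))$ for $1\le j\le s$, $\lambda(2(k+j)-1;(x_{(2j-1,k)},x_{(j-1,k)}+L'_j))$ for $2\le j\le s$, and $\lambda(2k+1;(p^k(p-1),L_1+p^ku_1))$; below floor $2k+1$ the path is forced. The blocks are, for $2\le j\le s$, $$m_{2(k+j)-1}=p^ku_j,\quad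 n_{2(k+j)-1}=p^k(p-1-u_j),\quad n_{2(k+j)-2}=L'_j-\lfloor L'_j/p\rfloor,\quad m_{2(k+j)-2}=p^k(p-1)-n_{2(k+j)-2},$$ and $m_{2k+1}=p^ku_1$, $n_{2k+1}=p^k(p-2-u_1)$. Descents. For $2k+2\le i\le 2r-2$, $P$ has a descent at block $i$ if $m_i>m_{i+1}$ and $n_i<n_{i+1}$ (these blocks all have size $m_i+n_i=p^k(p-1)$). By convention $P$ has a descent at block $2k$ if and only if $u_1<\frac{p-1}{2}$, it has no descent at block $2k+1$, and none at blocks below $2k$. $\mathrm{des}(P)$ is the number of descents of $P$. The $p^{(k)}$-Fibonacci number of the vertex is $$\mathcal M_{s,k}(l):=\mathcal M\big(\lambda(2r;(x_{(2s,k)},x_{(s,k)}+l))\big)=\sum_{P\in P^{2r}_l}\mathrm{des}(P).$$ *)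

theory Defs
  imports "HOL-Library.FuncSet" "HOL-Computational_Algebra.Primes"
begin

text \<open>The truncated subtraction is harmless: \<open>a + 1 \<le> a * p\<close> for \<open>a \<ge> 1\<close> and \<open>p \<ge> 2\<close>.\<close>

definition xnum :: "nat \<Rightarrow> nat \<Rightarrow> nat \<Rightarrow> nat" where
  "xnum p k a = p ^ k * (a * p - (a + 1))"

text \<open>\<open>Hook c n i\<close> is the vertex \<open>\<lambda>(c; (n, i))\<close>: the hook partition \<open>(n - i, 1\<^sup>i)\<close> of \<open>n\<close> on
  floor \<open>c\<close>. It has \<open>i\<close> vertical nodes; the other \<open>n - i\<close> nodes, the corner included, are
  counted as horizontal.\<close>

datatype vertex = Hook (floor_of: nat) (size_of: nat) (leg_of: nat)

definition arm_of :: "vertex \<Rightarrow> nat" where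
  "arm_of v = size_of v - leg_of v"

text \<open>The choices \<open>u\<^sub>s, \<dots>, u\<^sub>2 \<in> {0,\<dots>,p-1}\<close> and \<open>u\<^sub>1 \<in> {0,\<dots>,p-2}\<close>, as functions that are
  \<open>undefined\<close> outside \<open>{1..s}\<close>.\<close>

definition choices :: "nat \<Rightarrow> nat \<Rightarrow> (nat \<Rightarrow> nat) set" where
  "choices p s = (\<Pi>\<^sub>E j\<in>{1..s}. if j = 1 then {0..p - 2} else {0..p - 1})"

text \<open>\<open>Ldown p k s l u d\<close> is \<open>L\<^bsub>s-d\<^esub>\<close>, so that the recursion runs from \<open>j = s\<close> downwards.\<close>

primrec Ldown :: "nat \<Rightarrow> nat \<Rightarrow> nat \<Rightarrow> nat \<Rightarrow> (nat \<Rightarrow> nat) \<Rightarrow> nat \<Rightarrow> nat" where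
  "Ldown p k s l u 0 = l"
| "Ldown p k s l u (Suc d) = (Ldown p k s l u d + p ^ k * u (s - d)) div p"

definition Lval :: "nat \<Rightarrow> nat \<Rightarrow> nat \<Rightarrow> nat \<Rightarrow> (nat \<Rightarrow> nat) \<Rightarrow> nat \<Rightarrow> nat" where
  "Lval p k s l u j = Ldown p k s l u (s - j)"

definition Lval' :: "nat \<Rightarrow> nat \<Rightarrow> nat \<Rightarrow> nat \<Rightarrow> (nat \<Rightarrow> nat) \<Rightarrow> nat \<Rightarrow> nat" where
  "Lval' p k s l u j = Lval p k s l u j + p ^ k * u j"

text \<open>A path is the function sending each floor to the vertex visited there. Below floor
  \<open>2 * k + 1\<close> the path is forced, so only the floors \<open>2 * k + 1, \<dots>, 2 * (k + s)\<close> are recorded.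
  With \<open>j = (c + 1) div 2 - k\<close>, the floor \<open>c\<close> is \<open>2 * (k + j)\<close> or \<open>2 * (k + j) - 1\<close>.\<close>

definition bratteli_path ::
  "nat \<Rightarrow> nat \<Rightarrow> nat \<Rightarrow> nat \<Rightarrow> (nat \<Rightarrow> nat) \<Rightarrow> nat \<Rightarrow> vertex" where
  "bratteli_path p k s l u = (\<lambda>c\<in>{2 * k + 1..2 * (k + s)}.
     let j = (c + 1) div 2 - k in
     if c = 2 * k + 1 then Hook c (p ^ k * (p - 1)) (Lval p k s l u 1 + p ^ k * u 1)
     else if even c then Hook c (xnum p k (2 * j)) (xnum p k j + Lval p k s l u j)
     else Hook c (xnum p k (2 * j - 1)) (xnum p k (j - 1) + Lval' p k s l u j))"

text \<open>The set of all downward paths from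
  \<open>Hook (2 * (k + s)) (xnum p k (2 * s)) (xnum p k s + l)\<close>.\<close>

definition paths :: "nat \<Rightarrow> nat \<Rightarrow> nat \<Rightarrow> nat \<Rightarrow> (nat \<Rightarrow> vertex) set" where
  "paths p k s l = bratteli_path p k s l ` choices p s"

text \<open>Block \<open>i\<close> is removed in passing from floor \<open>i + 1\<close> to floor \<open>i\<close>. Their
  closed forms are derived below.\<close>

definition block_m :: "(nat \<Rightarrow> vertex) \<Rightarrow> nat \<Rightarrow> nat" where
  "block_m P i = arm_of (P (i + 1)) - arm_of (P i)"

definition block_n :: "(nat \<Rightarrow> vertex) \<Rightarrow> nat \<Rightarrow> nat" where
  "block_n P i = leg_of (P (i + 1)) - leg_of (P i)"

definition has_descent :: "nat \<Rightarrow> nat \<Rightarrow> nat \<Rightarrow> nat \<Rightarrow> (nat \<Rightarrow> vertex) \<Rightarrow> nat \<Rightarrow> bool" where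
  "has_descent p k s l P i \<longleftrightarrow>
     (if i = 2 * k
      then \<exists>u\<in>choices p s. P = bratteli_path p k s l u \<and> u 1 < (p - 1) div 2
      else 2 * k + 2 \<le> i \<and> i \<le> 2 * (k + s) - 2 \<and>
           block_m P i > block_m P (i + 1) \<and> block_n P i < block_n P (i + 1))"

definition des :: "nat \<Rightarrow> nat \<Rightarrow> nat \<Rightarrow> nat \<Rightarrow> (nat \<Rightarrow> vertex) \<Rightarrow> nat" where
  "des p k s l P = card {i \<in> {..2 * (k + s) - 1}. has_descent p k s l P i}"

definition fibonacci_number :: "nat \<Rightarrow> nat \<Rightarrow> nat \<Rightarrow> nat \<Rightarrow> nat" where
  "fibonacci_number p k s l = (\<Sum>P\<in>paths p k s l. des p k s l P)"


lemma choices_less: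
  assumes "u \<in> choices p s" "2 \<le> p" "1 \<le> j" "j \<le> s"
  shows "u j < p" and "j = 1 \<Longrightarrow> u j < p - 1"
proof -
  have "u j \<in> (if j = 1 then {0..p - 2} else {0..p - 1})"
    using assms unfolding choices_def by (auto simp: PiE_iff simp del: One_nat_def)
  then show "u j < p" and "j = 1 \<Longrightarrow> u j < p - 1"
    using assms(2) by (auto split: if_splits)
qed

lemma L_top: "Lval p k s l u s = l"
  by (simp add: Lval_def)

lemma L_step:
  assumes "2 \<le> j" "j \<le> s"
  shows "Lval p k s l u (j - 1) = Lval' p k s l u j div p"
proof -
  have "s - (j - 1) = Suc (s - j)" "s - (s - j) = j" using assms by auto
  then show ?thesis by (simp add: Lval_def Lval'_def)
qed

lemma L'_less_if:
  assumes "u \<in> choices p s" "2 \<le> p" "1 \<le> j" "j \<le> s" "Lval p k s l u j < p ^ k"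
  shows "Lval' p k s l u j < p * p ^ k"
proof -
  have "Suc (u j) * p ^ k \<le> p * p ^ k"
    using choices_less(1)[OF assms(1-4)] by (intro mult_right_mono) auto
  then show ?thesis using assms(5) by (simp add: Lval'_def algebra_simps)
qed

lemma L_less:
  assumes "u \<in> choices p s" "2 \<le> p" "1 \<le> j" "j \<le> s" "l < p ^ k"
  shows "Lval p k s l u j < p ^ k"
  using assms(4,3)
proof (induction j rule: inc_induct)
  case base
  then show ?case using assms(5) by (simp add: L_top)
next
  case (step j)
  then have "Lval p k s l u (Suc j) < p ^ k" by simp
  then have "Lval' p k s l u (Suc j) < p * p ^ k"
    using L'_less_if[OF assms(1,2), of "Suc j"] step by simp
  moreover have "Lval p k s l u j = Lval' p k s l u (Suc j) div p"
    using L_step[of "Suc j" s] step by simp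
  ultimately show ?case by (simp add: less_mult_imp_div_less mult.commute)
qed

lemma L'_less:
  assumes "u \<in> choices p s" "2 \<le> p" "1 \<le> j" "j \<le> s" "l < p ^ k"
  shows "Lval' p k s l u j < p * p ^ k"
  using L'_less_if[OF assms(1-4) L_less[OF assms]] .

lemma path_even:
  assumes "1 \<le> j" "j \<le> s"
  shows "bratteli_path p k s l u (2 * (k + j)) =
    Hook (2 * (k + j)) (xnum p k (2 * j)) (xnum p k j + Lval p k s l u j)"
proof -
  have "2 * (k + j) \<noteq> 2 * k + 1" by presburger
  moreover have "(2 * (k + j) + 1) div 2 - k = j" by simp
  ultimately show ?thesis using assms by (simp add: bratteli_path_def Let_def)
qed

lemma path_odd:
  assumes "2 \<le> j" "j \<le> s"
  shows "bratteli_path p k s l u (2 * (k + j) - 1) =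
    Hook (2 * (k + j) - 1) (xnum p k (2 * j - 1)) (xnum p k (j - 1) + Lval' p k s l u j)"
proof -
  obtain i where j: "j = i + 2" using assms(1) by (metis le_Suc_ex add.commute)
  have c: "2 * (k + j) - 1 = 2 * (k + i) + 3" by (simp add: j)
  have "(2 * (k + i) + 3 + 1) div 2 - k = j" by (simp add: j)
  moreover have "odd (2 * (k + i) + 3)" by simp
  ultimately show ?thesis using assms unfolding c by (simp add: bratteli_path_def Let_def j)
qed

lemma path_bottom:
  assumes "1 \<le> s"
  shows "bratteli_path p k s l u (2 * k + 1) =
    Hook (2 * k + 1) (p ^ k * (p - 1)) (Lval p k s l u 1 + p ^ k * u 1)"
  using assms by (simp add: bratteli_path_def Let_def)

lemma path_start:
  assumes "1 \<le> s"
  shows "bratteli_path p k s l u (2 * (k + s)) =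
    Hook (2 * (k + s)) (xnum p k (2 * s)) (xnum p k s + l)"
  using path_even[of s s] assms by (simp add: L_top)

lemma inj_on_bratteli_path:
  assumes "2 \<le> p" "1 \<le> s"
  shows "inj_on (bratteli_path p k s l) (choices p s)"
proof (rule inj_onI)
  fix u v
  assume u: "u \<in> choices p s" and v: "v \<in> choices p s"
    and eq: "bratteli_path p k s l u = bratteli_path p k s l v"
  have "u j = v j" if j: "1 \<le> j" "j \<le> s" for j
  proof -
    have L: "Lval p k s l u j = Lval p k s l v j"
      using path_even[OF j, of p k l u] path_even[OF j, of p k l v] eq by simp
    show ?thesis
    proof (cases "j = 1")
      case True
      then show ?thesis
        using path_bottom[OF assms(2), of p k l u] path_bottom[OF assms(2), of p k l v] eq L
          assms(1) by simp
    next
      case False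
      then have "2 \<le> j" using j by simp
      then have "Lval' p k s l u j = Lval' p k s l v j"
        using path_odd[of j s p k l u] path_odd[of j s p k l v] eq j by simp
      then show ?thesis using L assms(1) by (simp add: Lval'_def)
    qed
  qed
  then show "u = v"
    using u v unfolding choices_def by (intro PiE_ext) auto
qed

lemma xnum_int:
  assumes "2 \<le> p" "1 \<le> a"
  shows "int (xnum p k a) = int p ^ k * (int a * (int p - 1) - 1)"
proof -
  have "a * 2 \<le> a * p" using assms(1) by (rule mult_le_mono2)
  then have "a + 1 \<le> a * p" using assms(2) by linarith
  then have "int (a * p - (a + 1)) = int a * (int p - 1) - 1"
    by (simp only: of_nat_diff of_nat_mult of_nat_add of_nat_1 algebra_simps)
  then show ?thesis by (simp add: xnum_def)
qed

text \<open>The subtractions in the definitions of the blocks are never truncated, and the blocks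
  have the following closed forms.\<close>

lemma block_eqI:
  assumes "P (i + 1) = Hook c N a" "P i = Hook c' N' a'"
    and "a' \<le> N'" "int N - int N' = int m + int n" "int a - int a' = int n"
  shows "block_m P i = m" "block_n P i = n"
  using assms by (auto simp: block_m_def block_n_def arm_of_def)

lemma Lval_step_le:
  assumes "2 \<le> p" "u \<in> choices p s" "l < p ^ k" "1 \<le> j" "j \<le> s"
  shows "Lval' p k s l u j - Lval' p k s l u j div p \<le> p ^ k * (p - 1)"
proof -
  define q where "q = Lval' p k s l u j div p"
  define t where "t = Lval' p k s l u j mod p"
  have e: "Lval' p k s l u j = q * p + t" by (simp add: q_def t_def)
  have "q < p ^ k"
    using L'_less[OF assms(2,1,4,5,3)] unfolding q_def
    by (simp add: less_mult_imp_div_less mult.commute)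
  then have "Suc q * (p - 1) \<le> p ^ k * (p - 1)" by (intro mult_right_mono) auto
  moreover have "t < p"
    using assms(1) unfolding t_def by simp
  moreover have "q * p + t - q = q * (p - 1) + t"
    using assms(1) by (cases p) auto
  ultimately show ?thesis unfolding q_def[symmetric] e by simp
qed

lemma
  assumes "2 \<le> p" "u \<in> choices p s" "l < p ^ k" "2 \<le> j" "j \<le> s"
  shows block_m_odd: "block_m (bratteli_path p k s l u) (2 * (k + j) - 1) = p ^ k * u j"
    and block_n_odd: "block_n (bratteli_path p k s l u) (2 * (k + j) - 1) = p ^ k * (p - 1 - u j)"
proof -
  have uj: "u j < p" using choices_less(1)[OF assms(2,1)] assms by simp
  have i: "2 * (k + j) - 1 + 1 = 2 * (k + j)" using assms by simp
  have v1: "bratteli_path p k s l u (2 * (k + j) - 1 + 1) =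
      Hook (2 * (k + j)) (xnum p k (2 * j)) (xnum p k j + Lval p k s l u j)"
    unfolding i using path_even[of j s] assms by simp
  note v2 = path_odd[OF assms(4,5), of p k l u]
  have "int (Lval' p k s l u j) < int p ^ k * int p"
    using L'_less[OF assms(2,1) _ assms(5,3)] assms(4)
    by (metis le_trans mult.commute of_nat_less_iff of_nat_mult of_nat_power one_le_numeral)
  moreover have "int p ^ k * int p \<le> int p ^ k * (int j * (int p - 1))"
  proof (rule mult_left_mono)
    have "2 * (int p - 1) \<le> int j * (int p - 1)"
      using assms by (intro mult_right_mono) auto
    moreover have "int p \<le> 2 * (int p - 1)" using assms(1) by simp
    ultimately show "int p \<le> int j * (int p - 1)" by (rule order_trans[rotated])
  qed simp
  moreover have "int (xnum p k (2 * j - 1)) - int (xnum p k (j - 1)) =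
      int p ^ k * (int j * (int p - 1))"
    using assms by (simp add: xnum_int of_nat_diff) (simp add: algebra_simps)
  ultimately have fit: "xnum p k (j - 1) + Lval' p k s l u j \<le> xnum p k (2 * j - 1)"
    by linarith
  have "int (xnum p k (2 * j)) - int (xnum p k (2 * j - 1)) =
      int (p ^ k * u j) + int (p ^ k * (p - 1 - u j))"
    using assms uj by (simp add: xnum_int of_nat_diff) (simp add: algebra_simps)
  moreover have "int (xnum p k j + Lval p k s l u j) - int (xnum p k (j - 1) + Lval' p k s l u j) =
      int (p ^ k * (p - 1 - u j))"
    using assms uj by (simp add: xnum_int of_nat_diff Lval'_def) (simp add: algebra_simps)
  ultimately show "block_m (bratteli_path p k s l u) (2 * (k + j) - 1) = p ^ k * u j"
    and "block_n (bratteli_path p k s l u) (2 * (k + j) - 1) = p ^ k * (p - 1 - u j)"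
    by (blast intro: block_eqI[where P = "bratteli_path p k s l u", OF v1 v2 fit])+
qed

lemma
  assumes "2 \<le> p" "u \<in> choices p s" "l < p ^ k" "2 \<le> j" "j \<le> s"
  shows block_m_even: "block_m (bratteli_path p k s l u) (2 * (k + j) - 2) =
      p ^ k * (p - 1) - (Lval' p k s l u j - Lval' p k s l u j div p)"
    and block_n_even: "block_n (bratteli_path p k s l u) (2 * (k + j) - 2) =
      Lval' p k s l u j - Lval' p k s l u j div p"
proof -
  let ?n = "Lval' p k s l u j - Lval' p k s l u j div p"
  have i: "2 * (k + j) - 2 + 1 = 2 * (k + j) - 1" "2 * (k + j) - 2 = 2 * (k + (j - 1))"
    using assms by auto
  have v1: "bratteli_path p k s l u (2 * (k + j) - 2 + 1) =
      Hook (2 * (k + j) - 1) (xnum p k (2 * j - 1)) (xnum p k (j - 1) + Lval' p k s l u j)"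
    unfolding i(1) by (rule path_odd[OF assms(4,5)])
  have v2: "bratteli_path p k s l u (2 * (k + j) - 2) =
      Hook (2 * (k + (j - 1))) (xnum p k (2 * (j - 1)))
        (xnum p k (j - 1) + Lval' p k s l u j div p)"
    unfolding i(2) using path_even[of "j - 1" s p k l u] L_step[of j s p k l u] assms by simp
  have "Lval' p k s l u j div p < p ^ k"
    using L'_less[OF assms(2,1) _ assms(5,3)] assms(4)
    by (simp add: less_mult_imp_div_less mult.commute)
  then have "int (Lval' p k s l u j div p) < int p ^ k"
    by (metis of_nat_less_iff of_nat_power)
  moreover have "int p ^ k * 1 \<le> int p ^ k * ((int j - 1) * (int p - 1))"
  proof (rule mult_left_mono)
    have "1 * 1 \<le> (int j - 1) * (int p - 1)"
      using assms by (intro mult_mono) auto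
    then show "1 \<le> (int j - 1) * (int p - 1)" by simp
  qed simp
  moreover have "int (xnum p k (2 * (j - 1))) - int (xnum p k (j - 1)) =
      int p ^ k * ((int j - 1) * (int p - 1))"
    using assms by (simp add: xnum_int of_nat_diff) (simp add: algebra_simps)
  ultimately have fit: "xnum p k (j - 1) + Lval' p k s l u j div p \<le> xnum p k (2 * (j - 1))"
    by linarith
  have le: "?n \<le> p ^ k * (p - 1)"
    using Lval_step_le[OF assms(1-3)] assms by simp
  have "int (xnum p k (2 * j - 1)) - int (xnum p k (2 * (j - 1))) = int (p ^ k * (p - 1))"
    using assms by (simp add: xnum_int of_nat_diff) (simp add: algebra_simps)
  then have "int (xnum p k (2 * j - 1)) - int (xnum p k (2 * (j - 1))) =
      int (p ^ k * (p - 1) - ?n) + int ?n"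
    using le by linarith
  moreover have "int (xnum p k (j - 1) + Lval' p k s l u j)
      - int (xnum p k (j - 1) + Lval' p k s l u j div p) = int ?n"
    using div_le_dividend[of "Lval' p k s l u j" p] by linarith
  ultimately show "block_m (bratteli_path p k s l u) (2 * (k + j) - 2) = p ^ k * (p - 1) - ?n"
    and "block_n (bratteli_path p k s l u) (2 * (k + j) - 2) = ?n"
    by (blast intro: block_eqI[where P = "bratteli_path p k s l u", OF v1 v2 fit])+
qed

lemma
  assumes "2 \<le> p" "u \<in> choices p s" "l < p ^ k" "1 \<le> s"
  shows block_m_bottom: "block_m (bratteli_path p k s l u) (2 * k + 1) = p ^ k * u 1"
    and block_n_bottom: "block_n (bratteli_path p k s l u) (2 * k + 1) = p ^ k * (p - 2 - u 1)"
proof -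
  have u1: "u 1 < p - 1" using choices_less(2)[OF assms(2,1)] assms by simp
  have v1: "bratteli_path p k s l u (2 * k + 1 + 1) =
      Hook (2 * (k + 1)) (xnum p k (2 * 1)) (xnum p k 1 + Lval p k s l u 1)"
    using path_even[of 1 s p k l u] assms(4) by simp
  note v2 = path_bottom[OF assms(4), of p k l u]
  have "Lval p k s l u 1 < p ^ k"
    using L_less[OF assms(2,1) _ assms(4,3)] by simp
  moreover have "Suc (u 1) * p ^ k \<le> (p - 1) * p ^ k"
    using u1 by (intro mult_right_mono) auto
  ultimately have fit: "Lval p k s l u 1 + p ^ k * u 1 \<le> p ^ k * (p - 1)"
    by (simp add: mult.commute)
  have "int (xnum p k (2 * 1)) - int (p ^ k * (p - 1)) =
      int (p ^ k * u 1) + int (p ^ k * (p - 2 - u 1))"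
    using assms u1 by (simp add: xnum_int of_nat_diff) (simp add: algebra_simps)
  moreover have "int (xnum p k 1 + Lval p k s l u 1) - int (Lval p k s l u 1 + p ^ k * u 1) =
      int (p ^ k * (p - 2 - u 1))"
    using assms u1 by (simp add: xnum_int of_nat_diff) (simp add: algebra_simps)
  ultimately show "block_m (bratteli_path p k s l u) (2 * k + 1) = p ^ k * u 1"
    and "block_n (bratteli_path p k s l u) (2 * k + 1) = p ^ k * (p - 2 - u 1)"
    by (blast intro: block_eqI[where P = "bratteli_path p k s l u", OF v1 v2 fit])+
qed

lemma has_descent_bottom:
  assumes "2 \<le> p" "1 \<le> s" "u \<in> choices p s"
  shows "has_descent p k s l (bratteli_path p k s l u) (2 * k) \<longleftrightarrow> u 1 < (p - 1) div 2"
  using assms inj_on_bratteli_path[OF assms(1,2), of k l]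
  by (auto simp: has_descent_def inj_on_def)

lemma fibonacci_number_choices:
  assumes "2 \<le> p" "1 \<le> s"
  shows "fibonacci_number p k s l =
    (\<Sum>u\<in>choices p s. des p k s l (bratteli_path p k s l u))"
  unfolding fibonacci_number_def paths_def
  by (simp add: sum.reindex[OF inj_on_bratteli_path[OF assms]])

end

theory Submission
  imports Defs
begin

text \<open>
  Put \<open>Q = p\<^sup>k\<close> and let \<open>Y\<^sub>j\<close> be the number with base-\<open>p\<close> digits \<open>u\<^sub>j \<dots> u\<^sub>s\<close>, the digit \<open>u\<^sub>s\<close> being the
  least significant. Iterating the recursion gives \<open>L'\<^sub>j = \<lfloor>(l + Q Y\<^sub>j) / p\<^bsup>s-j\<^esup>\<rfloor>\<close>. A descent at block
  \<open>2(k+j)-2\<close> means \<open>2 L'\<^sub>j + 1 < pQ\<close>; a descent at block \<open>2(k+j)-1\<close> means that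
  \<open>u\<^sub>j + u\<^bsub>j+1\<^esub> \<ge> p\<close>, or \<open>u\<^sub>j + u\<^bsub>j+1\<^esub> = p - 1\<close> and \<open>L\<^bsub>j+1\<^esub> > u\<^bsub>j+1\<^esub> (Q-1)/(p-1)\<close>. All these conditions
  compare \<open>l + Q Y\<close> with a constant, where \<open>Y\<close> runs uniformly over an initial segment of the
  naturals, so \<open>l\<close> influences the number of solutions only through a carry. With
  \<open>B\<^sub>m = p\<^sup>m + \<dots> + p\<^bsup>k-1\<^esup>\<close> and \<open>h = (p-1)/2\<close> the outcome is
  \<open>M/h = 2(s-1)p\<^bsup>s-1\<^esup> + 1 - 2 \<Sum>\<^bsub>m\<le>s-2\<^esub> p\<^bsup>s-2-m\<^esup> [h B\<^sub>m \<le> l] + 2 \<Sum>\<^bsub>m\<le>s-3\<^esub> p\<^bsup>s-3-m\<^esup> #{v < p. v B\<^sub>m + p\<^sup>m \<le> l}\<close>.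
  The thresholds \<open>v B\<^sub>m + p\<^sup>m\<close> increase lexicographically in \<open>(v, m)\<close>, and the \<open>h B\<^sub>m\<close> all lie between
  the thresholds for \<open>v = h - 1\<close> and those for \<open>v = h\<close>; the cases list the resulting intervals.\<close>

subsection \<open>Sums over the choices\<close>

lemma sum_PiE_insert:
  assumes "x \<notin> S"
  shows "(\<Sum>u\<in>PiE (insert x S) F. g u) = (\<Sum>y\<in>F x. \<Sum>u\<in>PiE S F. g (u(x := y)))"
proof -
  have "(\<Sum>u\<in>PiE (insert x S) F. g u) =
      (\<Sum>(y, u)\<in>F x \<times> PiE S F. g (u(x := y)))"
    unfolding PiE_insert_eq
    by (subst sum.reindex[OF inj_combinator[OF assms]]) (simp add: case_prod_unfold)
  then show ?thesis by (simp add: sum.cartesian_product)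
qed

text \<open>Coordinates that \<open>g\<close> does not read only multiply the sum by the number of
  their values; the induction removes them from the product one at a time.\<close>

lemma sum_PiE_independent:
  fixes g :: "('a \<Rightarrow> 'b) \<Rightarrow> 'c::comm_semiring_1"
  assumes "finite A" "A \<inter> B = {}" "\<And>x u y. x \<in> A \<Longrightarrow> g (u(x := y)) = g u"
  shows "(\<Sum>u\<in>PiE (A \<union> B) F. g u) = (\<Prod>x\<in>A. of_nat (card (F x))) * (\<Sum>u\<in>PiE B F. g u)"
  using assms
proof (induction A rule: finite_induct)
  case (insert x A)
  have "g (u(x := y)) = g u" for u y by (rule insert.prems(2)) simp
  with insert have "(\<Sum>u\<in>PiE (insert x A \<union> B) F. g u) = of_nat (card (F x)) * (\<Sum>u\<in>PiE (A \<union> B) F. g u)"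
    by (simp only: Un_insert_left, subst sum_PiE_insert) (auto simp del: fun_upd_apply)
  with insert show ?case by (simp add: mult.assoc)
qed simp

text \<open>The recursion reads \<open>u s\<close> first and divides it by \<open>p\<close> most
  often, so this digit gets the lowest weight.\<close>

definition suffix_value :: "nat \<Rightarrow> nat \<Rightarrow> (nat \<Rightarrow> nat) \<Rightarrow> nat \<Rightarrow> nat" where
  "suffix_value p s u j = (\<Sum>i=j..s. u i * p ^ (s - i))"

lemma suffix_value_upd: "x < j \<Longrightarrow> suffix_value p s (u(x := y)) j = suffix_value p s u j"
  by (simp add: suffix_value_def)

lemma suffix_value_Suc:
  "j \<le> s \<Longrightarrow> suffix_value p s u j = suffix_value p s u (Suc j) + u j * p ^ (s - j)"
  by (simp add: suffix_value_def sum.atLeast_Suc_atMost)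

text \<open>Each number below \<open>p ^ (Suc s - a)\<close> has exactly one string of
  base-\<open>p\<close> digits. The bound \<open>2 \<le> a\<close> keeps out \<open>u 1\<close>,
  which has only \<open>p - 1\<close> values.\<close>

lemma sum_suffix_value:
  fixes f :: "nat \<Rightarrow> int"
  assumes "2 \<le> p" "2 \<le> a" "a \<le> Suc s"
  shows "(\<Sum>u\<in>PiE {a..s} (\<lambda>j. if j = 1 then {0..p - 2} else {0..p - 1}). f (suffix_value p s u a)) =
    (\<Sum>y<p ^ (Suc s - a). f y)"
  using assms(3,2)
proof (induction a arbitrary: f rule: inc_induct)
  case base
  then show ?case by (simp add: suffix_value_def)
next
  case (step a)
  let ?F = "\<lambda>j::nat. if j = 1 then {0..p - 2} else {0..p - 1}"
  have ins: "{a..s} = insert a {Suc a..s}" using step by auto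
  have "(\<Sum>u\<in>PiE {a..s} ?F. f (suffix_value p s u a)) =
     (\<Sum>x=0..p-1. \<Sum>u\<in>PiE {Suc a..s} ?F. f (suffix_value p s u (Suc a) + x * p ^ (s - a)))"
    using step by (simp add: ins sum_PiE_insert suffix_value_Suc suffix_value_upd)
  also have "\<dots> = (\<Sum>x=0..p-1. \<Sum>y<p ^ (s - a). f (y + x * p ^ (s - a)))"
  proof (rule sum.cong[OF refl])
    fix x
    show "(\<Sum>u\<in>PiE {Suc a..s} ?F. f (suffix_value p s u (Suc a) + x * p ^ (s - a))) =
        (\<Sum>y<p ^ (s - a). f (y + x * p ^ (s - a)))"
      using step.IH[of "\<lambda>y. f (y + x * p ^ (s - a))"] step.prems by simp
  qed
  \<comment> \<open>The leading digit \<open>x\<close> selects one of \<open>p\<close> consecutive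
    intervals of equal length, which \<open>sum.nat_group\<close> then glues together.\<close>
  also have "\<dots> = (\<Sum>x<p. sum f {x * p ^ (s - a)..<x * p ^ (s - a) + p ^ (s - a)})"
  proof (rule sum.cong)
    show "{0..p-1} = {..<p}" using assms by auto
  next
    fix x
    show "(\<Sum>y<p ^ (s - a). f (y + x * p ^ (s - a))) =
      sum f {x * p ^ (s - a)..<x * p ^ (s - a) + p ^ (s - a)}"
      using sum.shift_bounds_nat_ivl[of f 0 "x * p ^ (s - a)" "p ^ (s - a)"]
      by (simp add: atLeast0LessThan add.commute)
  qed
  also have "\<dots> = (\<Sum>y<p ^ (Suc s - a). f y)"
    using step by (simp add: sum.nat_group Suc_diff_le)
  finally show ?case .
qed

text \<open>The ignored digits are \<open>u 1\<close> with \<open>p - 1\<close> values and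
  \<open>u 2\<close> up to \<open>u (a - 1)\<close> with \<open>p\<close> values each; these give
  the two factors.\<close>

lemma sum_choices_project:
  fixes g :: "(nat \<Rightarrow> nat) \<Rightarrow> int"
  assumes "2 \<le> p" "2 \<le> a" "a \<le> Suc s" "\<And>x u y. x < a \<Longrightarrow> g (u(x := y)) = g u"
  shows "(\<Sum>u\<in>choices p s. g u) = (int p - 1) * int p ^ (a - 2) *
    (\<Sum>u\<in>PiE {a..s} (\<lambda>j. if j = 1 then {0..p - 2} else {0..p - 1}). g u)"
proof -
  let ?F = "\<lambda>j::nat. if j = 1 then {0..p - 2} else {0..p - 1}"
  have "{1..s} = {1..<a} \<union> {a..s}" using assms by auto
  then have "(\<Sum>u\<in>choices p s. g u) = (\<Prod>x\<in>{1..<a}. int (card (?F x))) * (\<Sum>u\<in>PiE {a..s} ?F. g u)"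
    unfolding choices_def using assms(4) by (simp only:) (rule sum_PiE_independent; auto)
  moreover have "(\<Prod>x\<in>{1..<a}. int (card (?F x))) = (int p - 1) * int p ^ (a - 2)"
  proof -
    have "{1..<a} = insert 1 {2..<a}" using assms by auto
    then show ?thesis using assms(1) by (simp add: of_nat_diff)
  qed
  ultimately show ?thesis by simp
qed

lemma sum_choices_suffix_value:
  fixes f :: "nat \<Rightarrow> int"
  assumes "2 \<le> p" "2 \<le> j" "j \<le> s"
  shows "(\<Sum>u\<in>choices p s. f (suffix_value p s u j)) =
    (int p - 1) * int p ^ (j - 2) * (\<Sum>y<p ^ (Suc s - j). f y)"
  using assms
  by (subst sum_choices_project[of p j]) (simp_all add: suffix_value_upd sum_suffix_value[simplified])

text \<open>A descent at an odd block reads two digits separately and the later ones only through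
  their value. The sum over \<open>u j\<close> is moved innermost because the solutions are counted
  in this digit first.\<close>

lemma sum_choices_two_digits:
  fixes f :: "nat \<Rightarrow> nat \<Rightarrow> nat \<Rightarrow> int"
  assumes "2 \<le> p" "2 \<le> j" "j < s"
  shows "(\<Sum>u\<in>choices p s. f (u j) (u (Suc j)) (suffix_value p s u (Suc (Suc j)))) =
    (int p - 1) * int p ^ (j - 2) * (\<Sum>v<p. \<Sum>y<p ^ (s - Suc j). \<Sum>x<p. f x v y)"
proof -
  let ?F = "\<lambda>j::nat. if j = 1 then {0..p - 2} else {0..p - 1}"
  have "{j..s} = insert j (insert (Suc j) {Suc (Suc j)..s})" using assms by auto
  moreover have F: "?F i = {..<p}" if "2 \<le> i" for i using assms that by auto
  ultimately have "(\<Sum>u\<in>PiE {j..s} ?F. f (u j) (u (Suc j)) (suffix_value p s u (Suc (Suc j)))) =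
      (\<Sum>x<p. \<Sum>v<p. \<Sum>u\<in>PiE {Suc (Suc j)..s} ?F. f x v (suffix_value p s u (Suc (Suc j))))"
    using assms by (simp add: sum_PiE_insert suffix_value_upd del: One_nat_def)
  also have "\<dots> = (\<Sum>x<p. \<Sum>v<p. \<Sum>y<p ^ (s - Suc j). f x v y)"
  proof -
    have "(\<Sum>u\<in>PiE {Suc (Suc j)..s} ?F. f x v (suffix_value p s u (Suc (Suc j)))) =
        (\<Sum>y<p ^ (s - Suc j). f x v y)" for x v
      using sum_suffix_value[of p "Suc (Suc j)" s "f x v"] assms by simp
    then show ?thesis by simp
  qed
  also have "\<dots> = (\<Sum>v<p. \<Sum>y<p ^ (s - Suc j). \<Sum>x<p. f x v y)"
    by (subst sum.swap) (intro sum.cong refl sum.swap)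
  finally show ?thesis
    using assms by (subst sum_choices_project[of p j]) (simp_all add: suffix_value_upd)
qed

lemma sum_choices_bottom:
  assumes "2 \<le> p" "1 \<le> s" "h \<le> p - 1"
  shows "(\<Sum>u\<in>choices p s. of_bool (u 1 < h)) = int h * int p ^ (s - 1)"
proof -
  let ?F = "\<lambda>j::nat. if j = 1 then {0..p - 2} else {0..p - 1}"
  have "{1..s} = {2..s} \<union> {1}" using assms by auto
  then have "(\<Sum>u\<in>choices p s. of_bool (u 1 < h)) =
      (\<Prod>x\<in>{2..s}. int (card (?F x))) * (\<Sum>u\<in>PiE {1} ?F. of_bool (u 1 < h))"
    unfolding choices_def by (simp only:) (rule sum_PiE_independent; auto)
  moreover have "(\<Prod>x\<in>{2..s}. int (card (?F x))) = int p ^ (s - 1)"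
    using assms(1) by (simp add: Suc_diff_le)
  moreover have "(\<Sum>u\<in>PiE {1} ?F. of_bool (u 1 < h)) = int h"
  proof -
    have "{0..p - 2} \<inter> {y. y < h} = {..<h}" using assms by auto
    then show ?thesis by (simp add: sum_PiE_insert of_bool_def sum.If_cases)
  qed
  ultimately show ?thesis by simp
qed

section \<open>The recursion in closed form, and counting with a carry\<close>

lemma Lval_eq_div:
  assumes "j \<le> s" "0 < p"
  shows "Lval p k s l u j = (l + p ^ k * suffix_value p s u (Suc j)) div p ^ (s - j)"
  using assms(1)
proof (induction j rule: inc_induct)
  case base
  then show ?case by (simp add: L_top suffix_value_def)
next
  case (step j)
  have "Lval p k s l u j = (Lval p k s l u (Suc j) + p ^ k * u (Suc j)) div p"
  proof -
    have "s - j = Suc (s - Suc j)" "s - (s - Suc j) = Suc j" using step.hyps by auto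
    then show ?thesis by (simp add: Lval_def)
  qed
  \<comment> \<open>The weight of \<open>u (Suc j)\<close> in the suffix value is the divisor
    reached so far, so the digit passes through the division unchanged.\<close>
  also have "Lval p k s l u (Suc j) + p ^ k * u (Suc j) =
      (l + p ^ k * suffix_value p s u (Suc j)) div p ^ (s - Suc j)"
  proof -
    have "l + p ^ k * suffix_value p s u (Suc j) =
        (l + p ^ k * suffix_value p s u (Suc (Suc j))) + p ^ (s - Suc j) * (p ^ k * u (Suc j))"
      using step.hyps by (simp add: suffix_value_Suc[of "Suc j"] algebra_simps)
    then have "(l + p ^ k * suffix_value p s u (Suc j)) div p ^ (s - Suc j) =
        p ^ k * u (Suc j) + (l + p ^ k * suffix_value p s u (Suc (Suc j))) div p ^ (s - Suc j)"
      using assms(2) by (simp only: div_mult_self2 power_not_zero neq0_conv simp_thms)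
    then show ?thesis using step.IH by simp
  qed
  also have "\<dots> div p = (l + p ^ k * suffix_value p s u (Suc j)) div p ^ (s - j)"
  proof -
    have "p ^ (s - j) = p ^ (s - Suc j) * p"
      using step.hyps by (metis Suc_diff_Suc power_Suc2)
    then show ?thesis by (simp only: div_mult2_eq)
  qed
  finally show ?case .
qed

lemma Lval'_eq_div:
  assumes "j \<le> s" "0 < p"
  shows "Lval' p k s l u j = (l + p ^ k * suffix_value p s u j) div p ^ (s - j)"
proof -
  have "l + p ^ k * suffix_value p s u j =
      (l + p ^ k * suffix_value p s u (Suc j)) + p ^ (s - j) * (p ^ k * u j)"
    using assms by (simp add: suffix_value_Suc algebra_simps)
  then have "(l + p ^ k * suffix_value p s u j) div p ^ (s - j) =
      p ^ k * u j + (l + p ^ k * suffix_value p s u (Suc j)) div p ^ (s - j)"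
    using assms(2) by (simp only: div_mult_self2 power_not_zero neq0_conv simp_thms)
  then show ?thesis using assms by (simp add: Lval'_def Lval_eq_div)
qed

text \<open>Since \<open>l < Q\<close> and \<open>b \<le> Q\<close>, every \<open>y < a\<close>
  satisfies the inequality and every \<open>y > a\<close> fails it. Only \<open>y = a\<close>
  depends on \<open>l\<close>; this is the carry.\<close>

lemma sum_affine_less:
  fixes a b l N Q :: nat
  assumes "a < N" "b \<le> Q" "l < Q"
  shows "(\<Sum>y<N. of_bool (l + Q * y < Q * a + b) :: int) = int a + of_bool (l < b)"
proof -
  have "l + Q * y < Q * a + b \<longleftrightarrow> y < a + of_bool (l < b)" for y
  proof (cases y a rule: linorder_cases)
    case less
    then have "Q * Suc y \<le> Q * a" by (intro mult_le_mono2) simp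
    then show ?thesis using less assms by simp
  next
    case greater
    then have "Q * Suc a \<le> Q * y" by (intro mult_le_mono2) simp
    then show ?thesis using greater assms by simp
  qed simp
  moreover have "{..<N} \<inter> {y. y < a + of_bool (l < b)} = {..<a + of_bool (l < b)}"
    using assms(1) by auto
  ultimately show ?thesis by (simp add: sum.If_cases of_bool_def)
qed

subsection \<open>Descents\<close>

text \<open>The only delicate digit is \<open>u = (p - 1) div 2\<close>, where the left side says \<open>L < (L + Q u) div p\<close>;
  then \<open>L\<close> lies below the fixed point \<open>(Q - 1) div 2\<close> of this shift.\<close>

lemma even_descent_iff:
  fixes L Q p u :: nat
  assumes "odd p" "3 \<le> p" "odd Q" "L < Q" "u < p"
  shows "(L + Q * u) - (L + Q * u) div p < Q * (p - 1 - u) \<longleftrightarrow> 2 * (L + Q * u) + 1 < Q * p"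
proof -
  obtain h where h: "p = 2 * h + 1" using assms(1) by (auto elim: oddE)
  define d where "d = (L + Q * u) div p"
  have "Q * Suc u \<le> Q * p" using assms(5) by (intro mult_le_mono2) simp
  then have "L + Q * u < Q * p" using assms(4) by simp
  then have d: "d < Q" unfolding d_def by (simp add: less_mult_imp_div_less)
  consider "u < h" | "h < u" | "u = h" by linarith
  then show ?thesis
  proof cases
    case 1
    then have "Q * (u + 1) \<le> Q * (p - 1 - u)" "Q * (u + 1) \<le> Q * h"
      by (intro mult_le_mono2; simp add: h)+
    then show ?thesis using assms(4) by (simp add: h algebra_simps)
  next
    case 2
    then have "Q * (p - 1 - u) + Q * 1 \<le> Q * u" "Q * (h + 1) \<le> Q * u"
      unfolding distrib_left[symmetric] by (intro mult_le_mono2; simp add: h)+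
    then show ?thesis using d unfolding d_def[symmetric] by (simp add: h algebra_simps)
  next
    case 3
    have "Q * 1 \<le> Q * h" using assms(2) by (intro mult_le_mono2) (simp add: h)
    then have "0 < Q * h" "d < Q * h" using d by linarith+
    then have "(L + Q * u) - d < Q * (p - 1 - u) \<longleftrightarrow> Suc L \<le> d"
      using 3 by (simp add: h) linarith
    also have "\<dots> \<longleftrightarrow> Suc L * p \<le> L + Q * u"
      unfolding d_def by (rule less_eq_div_iff_mult_less_eq) (simp add: h)
    also have "\<dots> \<longleftrightarrow> 2 * L + 1 < Q"
    proof
      assume a: "Suc L * p \<le> L + Q * u"
      show "2 * L + 1 < Q"
      proof (rule ccontr)
        assume "\<not> 2 * L + 1 < Q"
        then have "Q * h \<le> (2 * L + 1) * h" by (intro mult_le_mono1) simp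
        then show False using a 3 by (simp add: h algebra_simps)
      qed
    next
      assume "2 * L + 1 < Q"
      \<comment> \<open>Oddness of \<open>Q\<close> improves the bound by one; the claim for
        \<open>u = h\<close> amounts to exactly \<open>2 * L + 3 \<le> Q\<close>.\<close>
      then have "2 * L + 3 \<le> Q" using assms(3) by presburger
      then have "(2 * L + 3) * h \<le> Q * h" by (rule mult_le_mono1)
      then show "Suc L * p \<le> L + Q * u"
        using 3 assms(2) by (simp add: h algebra_simps)
    qed
    finally show ?thesis using 3 by (simp add: h d_def algebra_simps)
  qed
qed

text \<open>The difference of \<open>L\<close> and \<open>(L + Q * v) div p\<close> is less than
  \<open>Q\<close> in size, so \<open>u + v\<close> decides unless it equals \<open>p - 1\<close>.
  In that case the inequality says that \<open>L\<close> exceeds the fixed point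
  \<open>v * Q / (p - 1) = v * R + v / (p - 1)\<close> of the shift.\<close>

lemma odd_descent_iff:
  fixes L Q R p u v :: nat
  assumes "2 \<le> p" "(p - 1) * R + 1 = Q" "L < Q" "u < p" "v < p"
  shows "Q * (p - 1 - u) < (L + Q * v) - (L + Q * v) div p \<longleftrightarrow>
    p \<le> u + v \<or> u + v = p - 1 \<and> v * R < L"
proof -
  define d where "d = (L + Q * v) div p"
  have "Q * Suc v \<le> Q * p" using assms(5) by (intro mult_le_mono2) simp
  then have "L + Q * v < Q * p" using assms(3) by simp
  then have d: "d < Q" unfolding d_def by (simp add: less_mult_imp_div_less)
  consider "p \<le> u + v" | "u + v < p - 1" | "u + v = p - 1" by linarith
  then show ?thesis
  proof cases
    case 1
    then have "Q * (p - 1 - u) + Q * 1 \<le> Q * v"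
      unfolding distrib_left[symmetric] using assms by (intro mult_le_mono2) simp
    then show ?thesis using 1 d unfolding d_def[symmetric] by simp
  next
    case 2
    then have "Q * (v + 1) \<le> Q * (p - 1 - u)" by (intro mult_le_mono2) simp
    then have "\<not> Q * (p - 1 - u) < (L + Q * v) - (L + Q * v) div p"
      using assms(3) by (simp only: not_less) (simp add: algebra_simps)
    then show ?thesis using 2 by simp
  next
    case 3
    then have "p - 1 - u = v" by simp
    then have "Q * (p - 1 - u) < (L + Q * v) - d \<longleftrightarrow> d < L" using d by auto
    also have "\<dots> \<longleftrightarrow> L + Q * v < L * p"
      unfolding d_def using assms(1) by (intro div_less_iff_less_mult) simp
    also have "\<dots> \<longleftrightarrow> Q * v < L * (p - 1)"
      using assms(1) by (cases p) auto
    also have "\<dots> \<longleftrightarrow> v * R < L"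
    proof
      assume a: "Q * v < L * (p - 1)"
      show "v * R < L"
      proof (rule ccontr)
        assume "\<not> v * R < L"
        then have "L * (p - 1) \<le> v * R * (p - 1)" by (intro mult_le_mono1) simp
        also have "\<dots> \<le> Q * v" unfolding assms(2)[symmetric] by (simp add: algebra_simps)
        finally show False using a by simp
      qed
    next
      assume a: "v * R < L"
      \<comment> \<open>For \<open>v = p - 1\<close> the product \<open>v * R\<close> would be
        \<open>Q - 1\<close>, which no \<open>L < Q\<close> exceeds. So the fractional part
        \<open>v / (p - 1)\<close> is below 1.\<close>
      have "v \<noteq> p - 1"
        using a assms(2,3) by auto
      then have "v < p - 1" using assms(5) by simp
      moreover have "(v * R + 1) * (p - 1) \<le> L * (p - 1)"
        using a by (intro mult_le_mono1) simp
      ultimately show "Q * v < L * (p - 1)"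
        unfolding assms(2)[symmetric] by (simp add: algebra_simps)
    qed
    finally have "Q * (p - 1 - u) < (L + Q * v) - d \<longleftrightarrow> v * R < L" .
    moreover have "\<not> p \<le> u + v" using 3 assms(1) by simp
    ultimately show ?thesis using 3 by (simp only: d_def simp_thms)
  qed
qed

text \<open>Both blocks have size \<open>p ^ k * (p - 1)\<close>, so the inequalities for
  \<open>block_m\<close> and \<open>block_n\<close> are equivalent and one of them suffices.\<close>

lemma has_descent_even:
  assumes "odd p" "3 \<le> p" "u \<in> choices p s" "l < p ^ k" "2 \<le> j" "j \<le> s"
  shows "has_descent p k s l (bratteli_path p k s l u) (2 * (k + j) - 2) \<longleftrightarrow>
    2 * Lval' p k s l u j + 1 < p ^ k * p"
proof -
  let ?P = "bratteli_path p k s l u" and ?n = "Lval' p k s l u j - Lval' p k s l u j div p"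
  have p: "2 \<le> p" using assms(2) by simp
  have uj: "u j < p" using choices_less(1)[OF assms(3) p] assms by simp
  have i: "2 * (k + j) - 2 + 1 = 2 * (k + j) - 1" "2 * (k + j) - 2 \<noteq> 2 * k"
    "2 * k + 2 \<le> 2 * (k + j) - 2" "2 * (k + j) - 2 \<le> 2 * (k + s) - 2"
    using assms by auto
  have le: "?n \<le> p ^ k * (p - 1)" using Lval_step_le[OF p assms(3,4)] assms by simp
  have eq: "p ^ k * (p - 1) = p ^ k * u j + p ^ k * (p - 1 - u j)"
    unfolding distrib_left[symmetric] using uj by simp
  have "has_descent p k s l ?P (2 * (k + j) - 2) \<longleftrightarrow>
      p ^ k * u j < p ^ k * (p - 1) - ?n \<and> ?n < p ^ k * (p - 1 - u j)"
    unfolding has_descent_def i(1)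
    using i block_m_even[OF p assms(3-6)] block_n_even[OF p assms(3-6)]
      block_m_odd[OF p assms(3-6)] block_n_odd[OF p assms(3-6)] by simp
  also have "\<dots> \<longleftrightarrow> ?n < p ^ k * (p - 1 - u j)" using le eq by linarith
  also have "\<dots> \<longleftrightarrow> 2 * Lval' p k s l u j + 1 < p ^ k * p"
    unfolding Lval'_def using L_less[OF assms(3) p _ assms(6,4)] assms uj
    by (intro even_descent_iff) auto
  finally show ?thesis .
qed

text \<open>The next block is the even block belonging to \<open>Suc j\<close>; hence
  \<open>j < s\<close> and the appearance of \<open>Lval\<close> at \<open>Suc j\<close>.\<close>

lemma has_descent_odd:
  assumes "2 \<le> p" "u \<in> choices p s" "l < p ^ k" "2 \<le> j" "j < s" "(p - 1) * R + 1 = p ^ k"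
  shows "has_descent p k s l (bratteli_path p k s l u) (2 * (k + j) - 1) \<longleftrightarrow>
    p \<le> u j + u (Suc j) \<or> u j + u (Suc j) = p - 1 \<and> u (Suc j) * R < Lval p k s l u (Suc j)"
proof -
  let ?P = "bratteli_path p k s l u"
  let ?n = "Lval' p k s l u (Suc j) - Lval' p k s l u (Suc j) div p"
  have j: "2 \<le> j" "j \<le> s" "2 \<le> Suc j" "Suc j \<le> s" using assms by auto
  have uj: "u j < p" "u (Suc j) < p"
    using choices_less(1)[OF assms(2,1)] assms by auto
  have i: "2 * (k + j) - 1 + 1 = 2 * (k + Suc j) - 2" "2 * (k + j) - 1 \<noteq> 2 * k"
    "2 * k + 2 \<le> 2 * (k + j) - 1" "2 * (k + j) - 1 \<le> 2 * (k + s) - 2"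
    using assms by auto
  have le: "?n \<le> p ^ k * (p - 1)" using Lval_step_le[OF assms(1-3)] assms by simp
  have eq: "p ^ k * (p - 1) = p ^ k * u j + p ^ k * (p - 1 - u j)"
    unfolding distrib_left[symmetric] using uj by simp
  have "has_descent p k s l ?P (2 * (k + j) - 1) \<longleftrightarrow>
      p ^ k * (p - 1) - ?n < p ^ k * u j \<and> p ^ k * (p - 1 - u j) < ?n"
    unfolding has_descent_def i(1)
    using i block_m_even[OF assms(1-3) j(3,4)] block_n_even[OF assms(1-3) j(3,4)]
      block_m_odd[OF assms(1-3) j(1,2)] block_n_odd[OF assms(1-3) j(1,2)] by simp
  also have "\<dots> \<longleftrightarrow> p ^ k * (p - 1 - u j) < ?n" using le eq by linarith
  also have "\<dots> \<longleftrightarrow> p \<le> u j + u (Suc j) \<or>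
      u j + u (Suc j) = p - 1 \<and> u (Suc j) * R < Lval p k s l u (Suc j)"
    unfolding Lval'_def using L_less[OF assms(2,1) _ j(4) assms(3)] assms uj
    by (intro odd_descent_iff) auto
  finally show ?thesis .
qed

text \<open>The two parities obey different criteria. From \<open>2 * k + 2\<close> to
  \<open>2 * (k + s) - 2\<close> the even positions belong to \<open>j = 2..s\<close> and the odd
  ones to \<open>j = 2..<s\<close>; the position \<open>2 * k\<close> has its own
  convention.\<close>

lemma des_eq_sum:
  assumes "1 \<le> s"
  shows "int (des p k s l P) = of_bool (has_descent p k s l P (2 * k)) +
    (\<Sum>j=2..s. of_bool (has_descent p k s l P (2 * (k + j) - 2))) +
    (\<Sum>j=2..<s. of_bool (has_descent p k s l P (2 * (k + j) - 1)))"
proof -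
  define D where "D = has_descent p k s l P"
  define A where "A = (if D (2 * k) then {2 * k} else {})"
  define E where "E = (\<lambda>j. 2 * (k + j) - 2) ` ({2..s} \<inter> {j. D (2 * (k + j) - 2)})"
  define F where "F = (\<lambda>j. 2 * (k + j) - 1) ` ({2..<s} \<inter> {j. D (2 * (k + j) - 1)})"
  have "{i \<in> {..2 * (k + s) - 1}. D i} = A \<union> E \<union> F"
  proof (intro equalityI subsetI)
    fix i assume "i \<in> {i \<in> {..2 * (k + s) - 1}. D i}"
    then have i: "D i" by simp
    then consider "i = 2 * k" | "2 * k + 2 \<le> i" "i \<le> 2 * (k + s) - 2"
      unfolding D_def has_descent_def by (auto split: if_splits)
    then show "i \<in> A \<union> E \<union> F"
    proof cases
      case 1
      then show ?thesis using i by (simp add: A_def)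
    next
      case 2
      show ?thesis
      proof (cases "even i")
        case True
        then obtain a where "i = 2 * a" by blast
        then have "i = 2 * (k + (a + 1 - k)) - 2" "a + 1 - k \<in> {2..s}" using 2 by auto
        then show ?thesis using i unfolding E_def by blast
      next
        case False
        then obtain a where "i = 2 * a + 1" by (blast elim: oddE)
        then have "i = 2 * (k + (a + 1 - k)) - 1" "a + 1 - k \<in> {2..<s}" using 2 by auto
        then show ?thesis using i unfolding F_def by blast
      qed
    qed
  qed (use assms in \<open>auto simp: A_def E_def F_def split: if_splits\<close>)
  moreover have "card (A \<union> E \<union> F) = card A + card E + card F"
  proof -
    have "finite A" "finite E" "finite F" by (simp_all add: A_def E_def F_def)
    moreover have "A \<inter> E = {}" by (auto simp: A_def E_def split: if_splits)
    moreover have "(A \<union> E) \<inter> F = {}"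
    proof -
      have "even i" if "i \<in> A \<union> E" for i using that by (auto simp: A_def E_def split: if_splits)
      moreover have "odd i" if "i \<in> F" for i using that by (auto simp: F_def)
      ultimately show ?thesis by blast
    qed
    ultimately show ?thesis using card_Un_disjoint[of "A \<union> E" F] card_Un_disjoint[of A E] by simp
  qed
  moreover have "int (card A) = of_bool (D (2 * k))" by (auto simp: A_def)
  moreover have "int (card E) = (\<Sum>j=2..s. of_bool (D (2 * (k + j) - 2)))"
    unfolding E_def by (subst card_image) (auto simp: inj_on_def)
  moreover have "int (card F) = (\<Sum>j=2..<s. of_bool (D (2 * (k + j) - 1)))"
    unfolding F_def by (subst card_image) (auto simp: inj_on_def)
  ultimately show ?thesis by (simp only: des_def D_def[symmetric] of_nat_add)
qed

text \<open>This is \<open>(p ^ k - p ^ m) / (p - 1)\<close> for \<open>m \<le> k\<close> and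
  \<open>p > 1\<close>; \<open>power_sum_eq\<close> says so without division or subtraction.\<close>

definition power_sum :: "nat \<Rightarrow> nat \<Rightarrow> nat \<Rightarrow> nat" where
  "power_sum p k m = (\<Sum>\<iota>=m..<k. p ^ \<iota>)"

lemma power_sum_eq:
  assumes "1 \<le> p" "m \<le> k"
  shows "(p - 1) * power_sum p k m + p ^ m = p ^ k"
  using assms(2)
proof (induction m rule: inc_induct)
  case base
  then show ?case by (simp add: power_sum_def)
next
  case (step m)
  have "power_sum p k m = p ^ m + power_sum p k (Suc m)"
    using step.hyps by (simp add: power_sum_def sum.atLeast_Suc_lessThan)
  then show ?case using step.IH assms(1) by (cases p) (simp_all add: algebra_simps)
qed

subsection \<open>Counting descents\<close>

text \<open>The criterion becomes \<open>l + p ^ k * Y < p ^ k * a + b\<close> with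
  \<open>a = (p ^ (Suc s - j) - 1) / 2\<close>, which has \<open>a\<close> solutions and one more if
  \<open>l < b\<close>. The factor 2 clears the half in \<open>a\<close>.\<close>

lemma sum_even_descents:
  assumes "odd p" "3 \<le> p" "s < k + 2" "l < p ^ k" "2 \<le> j" "j \<le> s"
  shows "2 * (\<Sum>u\<in>choices p s. of_bool (has_descent p k s l (bratteli_path p k s l u) (2 * (k + j) - 2))) =
    (int p - 1) * (int p ^ (s - 1) - int p ^ (j - 2) +
      2 * int p ^ (j - 2) * of_bool (l < (p - 1) div 2 * power_sum p k (s - j)))"
proof -
  obtain h where h: "p = 2 * h + 1" using assms(1) by (auto elim: oddE)
  define P where "P = p ^ (s - j)"
  define b where "b = h * power_sum p k (s - j)"
  have "odd (P * p)" "odd (p ^ k * p)" using assms(1) by (simp_all add: P_def)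
  then obtain a c where a: "P * p = 2 * a + 1" and c: "p ^ k * p = 2 * c + 1" by (meson oddE)
  have b: "2 * b + P = p ^ k"
  proof -
    have "1 \<le> p" "s - j \<le> k" using assms by auto
    from power_sum_eq[OF this] show ?thesis by (simp add: b_def P_def h)
  qed
  \<comment> \<open>The criterion reads \<open>L' < c\<close>, that is
    \<open>l + p ^ k * Y < c * P\<close>. Here \<open>c * P\<close> is split at \<open>p ^ k\<close>
    into quotient and remainder.\<close>
  have bound: "c * P = p ^ k * a + b"
  proof -
    have "(2 * c + 1) * P = p ^ k * (2 * a + 1)" unfolding a[symmetric] c[symmetric] by simp
    then show ?thesis using b by (simp add: algebra_simps)
  qed
  have "0 < P" using assms(2) by (simp add: P_def)
  then have iff: "2 * ((l + p ^ k * y) div P) + 1 < p ^ k * p \<longleftrightarrow> l + p ^ k * y < p ^ k * a + b" for y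
    unfolding bound[symmetric] c by (simp add: div_less_iff_less_mult)
  have "(\<Sum>u\<in>choices p s. of_bool (has_descent p k s l (bratteli_path p k s l u) (2 * (k + j) - 2))) =
      (\<Sum>u\<in>choices p s. of_bool (l + p ^ k * suffix_value p s u j < p ^ k * a + b) :: int)"
  proof (intro sum.cong refl arg_cong[where f = of_bool])
    fix u assume u: "u \<in> choices p s"
    have "Lval' p k s l u j = (l + p ^ k * suffix_value p s u j) div P"
      unfolding P_def using assms by (intro Lval'_eq_div) auto
    then show "has_descent p k s l (bratteli_path p k s l u) (2 * (k + j) - 2) \<longleftrightarrow>
        l + p ^ k * suffix_value p s u j < p ^ k * a + b"
      unfolding has_descent_even[OF assms(1,2) u assms(4-6)] by (simp only: iff)
  qed
  also have "\<dots> = (int p - 1) * int p ^ (j - 2) *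
      (\<Sum>y<p ^ (Suc s - j). of_bool (l + p ^ k * y < p ^ k * a + b))"
    using assms by (intro sum_choices_suffix_value) auto
  also have "(\<Sum>y<p ^ (Suc s - j). of_bool (l + p ^ k * y < p ^ k * a + b) :: int) = int a + of_bool (l < b)"
  proof (rule sum_affine_less)
    have "p ^ (Suc s - j) = P * p" using assms by (simp add: P_def Suc_diff_le)
    then show "a < p ^ (Suc s - j)" using a by simp
  qed (use b assms in auto)
  finally have *: "(\<Sum>u\<in>choices p s. of_bool (has_descent p k s l (bratteli_path p k s l u) (2 * (k + j) - 2))) =
      (int p - 1) * int p ^ (j - 2) * (int a + of_bool (l < b))" .
  have "int p ^ (j - 2) * (2 * int a + 1) = int p ^ (s - 1)"
  proof -
    have "s - 1 = (j - 2) + ((s - j) + 1)" using assms by simp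
    then have "p ^ (s - 1) = p ^ (j - 2) * (P * p)" by (simp only: P_def power_add power_one_right)
    then have "int (p ^ (s - 1)) = int (p ^ (j - 2) * (2 * a + 1))" unfolding a by simp
    then show ?thesis by (simp add: distrib_left)
  qed
  then have "2 * int p ^ (j - 2) * int a = int p ^ (s - 1) - int p ^ (j - 2)"
    by (simp add: algebra_simps)
  moreover have "2 * ((int p - 1) * int p ^ (j - 2) * (int a + of_bool (l < b))) =
      (int p - 1) * (2 * int p ^ (j - 2) * int a + 2 * int p ^ (j - 2) * of_bool (l < b))"
    by (simp add: algebra_simps)
  moreover have "b = (p - 1) div 2 * power_sum p k (s - j)" by (simp add: b_def h)
  ultimately show ?thesis unfolding * by simp
qed

text \<open>The least \<open>l\<close> at which the digit value \<open>v = u (Suc j)\<close> admits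
  one more suffix in the boundary case \<open>u j + v = p - 1\<close>. For \<open>v = p - 1\<close>
  and \<open>m \<le> k\<close> it is \<open>p ^ k\<close>, beyond the range of
  \<open>l\<close>.\<close>

definition threshold :: "nat \<Rightarrow> nat \<Rightarrow> nat \<Rightarrow> nat \<Rightarrow> nat" where
  "threshold p k m v = v * power_sum p k m + p ^ m"

definition threshold_count :: "nat \<Rightarrow> nat \<Rightarrow> nat \<Rightarrow> nat \<Rightarrow> nat" where
  "threshold_count p k l m = card {v. v < p \<and> threshold p k m v \<le> l}"

text \<open>For \<open>u (Suc j) = v\<close> exactly \<open>v\<close> values of \<open>u j\<close>
  give a descent outright, and the value \<open>p - 1 - v\<close> does so if \<open>C\<close> holds.
  Counting the suffixes with \<open>C\<close> leaves one carry for each \<open>v\<close>, and these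
  add up to \<open>threshold_count\<close>.\<close>

lemma sum_odd_descents:
  assumes "2 \<le> p" "s < k + 2" "l < p ^ k" "2 \<le> j" "j < s"
  shows "2 * (\<Sum>u\<in>choices p s. of_bool (has_descent p k s l (bratteli_path p k s l u) (2 * (k + j) - 1))) =
    (int p - 1) * (int p ^ (s - 1) - int p ^ (j - 1) +
      2 * int p ^ (j - 2) * int (threshold_count p k l (s - 1 - j)))"
proof -
  define m where "m = s - Suc j"
  define N where "N = p ^ m"
  define R where "R = power_sum p k 0"
  define G where "G = power_sum p m 0"
  define B where "B = power_sum p k m"
  define Q where "Q = p ^ k"
  have m: "m \<le> k" using assms by (simp add: m_def)
  have R: "(p - 1) * R + 1 = Q" using power_sum_eq[of p 0 k] assms(1) by (simp add: R_def Q_def)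
  have G: "(p - 1) * G + 1 = N" using power_sum_eq[of p 0 m] assms(1) by (simp add: G_def N_def)
  have B: "(p - 1) * B + N = Q" using power_sum_eq[of p m k] m assms(1) by (simp add: B_def N_def Q_def)
  \<comment> \<open>This splits \<open>(v * R + 1) * N\<close> at \<open>Q\<close>, with remainder
    \<open>v * B + N\<close>, the threshold of \<open>v\<close>. After multiplication by
    \<open>p - 1\<close> it reads \<open>(Q - 1) * N = Q * (N - 1) + (Q - N)\<close>.\<close>
  have RGB: "R * N = Q * G + B"
  proof -
    have "(p - 1) * (R * N) + N = (p - 1) * (Q * G + B) + N"
      using arg_cong[OF R, of "\<lambda>x. x * N"] arg_cong[OF G, of "\<lambda>x. Q * x"] B
      by (simp add: algebra_simps)
    then show ?thesis using assms(1) by simp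
  qed
  define C where "C v y \<longleftrightarrow> v * R < (l + Q * y) div N" for v y
  have N: "0 < N" using assms(1) by (simp add: N_def)
  have C_iff: "C v y \<longleftrightarrow> \<not> l + Q * y < Q * (v * G) + (v * B + N)" for v y
  proof -
    have "C v y \<longleftrightarrow> (v * R + 1) * N \<le> l + Q * y"
      unfolding C_def less_eq_div_iff_mult_less_eq[OF N, of "v * R + 1", symmetric] by auto
    moreover have "(v * R + 1) * N = Q * (v * G) + (v * B + N)"
      by (simp add: distrib_right mult.assoc RGB distrib_left mult.left_commute)
    ultimately show ?thesis by (simp only: not_less)
  qed
  have inner: "(\<Sum>x<p. of_bool (p \<le> x + v \<or> x + v = p - 1 \<and> b)) = int v + of_bool b"
    if "v < p" for v b
  proof -
    have "{..<p} \<inter> {x. p \<le> x + v \<or> x + v = p - 1 \<and> b} = {p - (v + of_bool b)..<p}"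
      using that by auto
    moreover have "(\<Sum>x<p. of_bool (p \<le> x + v \<or> x + v = p - 1 \<and> b)) =
        int (card ({..<p} \<inter> {x. p \<le> x + v \<or> x + v = p - 1 \<and> b}))"
      by (rule sum_of_bool_eq) simp_all
    ultimately show ?thesis using that by simp
  qed
  have count: "(\<Sum>y<N. int v + of_bool (C v y)) =
      int N * int v + (int N - 1 - int (v * G) + of_bool (v * B + N \<le> l))" if "v < p" for v
  proof -
    have "v * G \<le> (p - 1) * G" "v * B \<le> (p - 1) * B"
      using that by (intro mult_le_mono1; simp)+
    then have "v * G < N" "v * B + N \<le> Q" using G B by linarith+
    then have "(\<Sum>y<N. of_bool (l + Q * y < Q * (v * G) + (v * B + N)) :: int) =
        int (v * G) + of_bool (l < v * B + N)"
      using assms(3) by (intro sum_affine_less) (auto simp: Q_def)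
    moreover have "(\<Sum>y<N. of_bool (C v y) :: int) =
        (\<Sum>y<N. 1 - of_bool (l + Q * y < Q * (v * G) + (v * B + N)))"
      unfolding C_iff by (intro sum.cong) auto
    ultimately show ?thesis
      by (simp add: sum.distrib sum_subtractf not_less[symmetric])
  qed
  have gauss: "2 * (\<Sum>v<p. int v) = int p * (int p - 1)"
    by (induction p) (auto simp: algebra_simps)
  have thr: "(\<Sum>v<p. of_bool (v * B + N \<le> l)) = int (threshold_count p k l m)"
    by (simp add: threshold_count_def threshold_def B_def N_def lessThan_def Int_def)
  \<comment> \<open>Together with \<open>gauss\<close> this eliminates \<open>G\<close>: the doubled
    sum of \<open>G * v\<close> over all digits is \<open>p * (N - 1)\<close>.\<close>
  have Gi: "(int p - 1) * int G = int N - 1"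
    using G assms(1) by (simp add: of_nat_diff flip: G)
  have total: "2 * (\<Sum>v<p. \<Sum>y<N. int v + of_bool (C v y)) =
      int N * (int p * (int p - 1)) + int p * (int N - 1) + 2 * int (threshold_count p k l m)"
  proof -
    have "(\<Sum>v<p. \<Sum>y<N. int v + of_bool (C v y)) =
        (\<Sum>v<p. int N * int v + (int N - 1 - int G * int v + of_bool (v * B + N \<le> l)))"
      by (intro sum.cong refl) (simp add: count mult.commute)
    also have "\<dots> = int N * (\<Sum>v<p. int v) + int p * (int N - 1) - int G * (\<Sum>v<p. int v)
        + int (threshold_count p k l m)"
      unfolding thr[symmetric] by (simp add: sum.distrib sum_subtractf sum_distrib_left)
    finally have "2 * (\<Sum>v<p. \<Sum>y<N. int v + of_bool (C v y)) =
        int N * (2 * (\<Sum>v<p. int v)) + 2 * (int p * (int N - 1)) - int G * (2 * (\<Sum>v<p. int v))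
        + 2 * int (threshold_count p k l m)" by (simp only: algebra_simps)
    also have "\<dots> = int N * (int p * (int p - 1)) + 2 * (int p * (int N - 1)) - int p * ((int p - 1) * int G)
        + 2 * int (threshold_count p k l m)"
      unfolding gauss by (simp only: algebra_simps)
    finally show ?thesis unfolding Gi by simp
  qed
  have "(\<Sum>u\<in>choices p s. of_bool (has_descent p k s l (bratteli_path p k s l u) (2 * (k + j) - 1))) =
      (\<Sum>u\<in>choices p s. of_bool (p \<le> u j + u (Suc j) \<or>
        u j + u (Suc j) = p - 1 \<and> C (u (Suc j)) (suffix_value p s u (Suc (Suc j)))) :: int)"
  proof (intro sum.cong refl arg_cong[where f = of_bool])
    fix u assume u: "u \<in> choices p s"
    have "Lval p k s l u (Suc j) = (l + p ^ k * suffix_value p s u (Suc (Suc j))) div p ^ (s - Suc j)"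
      using assms by (intro Lval_eq_div) auto
    then show "has_descent p k s l (bratteli_path p k s l u) (2 * (k + j) - 1) \<longleftrightarrow>
        p \<le> u j + u (Suc j) \<or>
        u j + u (Suc j) = p - 1 \<and> C (u (Suc j)) (suffix_value p s u (Suc (Suc j)))"
      unfolding has_descent_odd[OF assms(1) u assms(3-5) R[unfolded Q_def]] C_def
      by (simp only: Q_def N_def m_def)
  qed
  also have "\<dots> = (int p - 1) * int p ^ (j - 2) * (\<Sum>v<p. \<Sum>y<N. \<Sum>x<p.
      of_bool (p \<le> x + v \<or> x + v = p - 1 \<and> C v y))"
    unfolding N_def m_def using assms
    by (intro sum_choices_two_digits[where f = "\<lambda>x v y. of_bool (p \<le> x + v \<or> x + v = p - 1 \<and> C v y)"]) auto
  also have "(\<Sum>v<p. \<Sum>y<N. \<Sum>x<p. of_bool (p \<le> x + v \<or> x + v = p - 1 \<and> C v y)) =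
      (\<Sum>v<p. \<Sum>y<N. int v + of_bool (C v y))"
    by (intro sum.cong refl inner) simp
  finally have *: "2 * (\<Sum>u\<in>choices p s. of_bool (has_descent p k s l (bratteli_path p k s l u) (2 * (k + j) - 1))) =
      (int p - 1) * int p ^ (j - 2) * (int N * (int p * (int p - 1)) + int p * (int N - 1)
        + 2 * int (threshold_count p k l m))"
    unfolding total[symmetric] by (simp only: mult.left_commute)
  have "s - 1 = (j - 2) + (m + 2)" "j - 1 = (j - 2) + 1" using assms by (auto simp: m_def)
  then have "int p ^ (s - 1) = int p ^ (j - 2) * (int N * int p ^ 2)"
    "int p ^ (j - 1) = int p ^ (j - 2) * int p"
    by (simp_all only: N_def power_add power_one_right of_nat_power)
  then show ?thesis unfolding * by (simp add: m_def power2_eq_square algebra_simps)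
qed

text \<open>The bottom descent, the \<open>s - 1\<close> even blocks and the \<open>s - 2\<close>
  odd blocks each contribute \<open>p ^ (s - 1)\<close>, which explains \<open>2 * (s - 1)\<close>.
  The substitution \<open>e = j - 2\<close> makes the weights \<open>p ^ e\<close>, and the
  indicators \<open>l < b\<close> are replaced by their complements.\<close>

lemma fibonacci_number_eq:
  assumes "odd p" "3 \<le> p" "2 \<le> s" "s < k + 2" "l < p ^ k"
  shows "int (fibonacci_number p k s l) = (int p - 1) div 2 *
    (2 * (int s - 1) * int p ^ (s - 1) + 1
     - 2 * (\<Sum>e=0..s-2. int p ^ e * of_bool ((p - 1) div 2 * power_sum p k (s - 2 - e) \<le> l))
     + 2 * (\<Sum>e<s-2. int p ^ e * int (threshold_count p k l (s - 3 - e))))"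
proof -
  obtain h where h: "p = 2 * h + 1" using assms(1) by (auto elim: oddE)
  obtain n where n: "s = n + 2" using assms(3) by (metis add.commute le_Suc_ex)
  let ?D = "\<lambda>u. has_descent p k s l (bratteli_path p k s l u)"
  let ?I = "\<lambda>e. of_bool ((p - 1) div 2 * power_sum p k (n - e) \<le> l) :: int"
  let ?T = "\<lambda>e. int (threshold_count p k l (n - 1 - e))"
  define q where "q = int p"
  have "2 * int (fibonacci_number p k s l) =
      2 * (\<Sum>u\<in>choices p s. of_bool (u 1 < (p - 1) div 2)) +
      (\<Sum>j=2..s. 2 * (\<Sum>u\<in>choices p s. of_bool (?D u (2 * (k + j) - 2)))) +
      (\<Sum>j=2..<s. 2 * (\<Sum>u\<in>choices p s. of_bool (?D u (2 * (k + j) - 1))))"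
  proof -
    have "int (fibonacci_number p k s l) = (\<Sum>u\<in>choices p s. of_bool (u 1 < (p - 1) div 2) +
        (\<Sum>j=2..s. of_bool (?D u (2 * (k + j) - 2))) + (\<Sum>j=2..<s. of_bool (?D u (2 * (k + j) - 1))))"
      using assms by (simp add: fibonacci_number_choices des_eq_sum has_descent_bottom)
    then show ?thesis
      unfolding sum_distrib_left[symmetric]
      by (simp add: sum.distrib sum.swap[of _ "choices p s"] del: sum_of_bool_eq)
  qed
  also have "2 * (\<Sum>u\<in>choices p s. of_bool (u 1 < (p - 1) div 2)) = (q - 1) * q ^ (s - 1)"
    using assms sum_choices_bottom[of p s h] by (simp add: h q_def)
  also have "(\<Sum>j=2..s. 2 * (\<Sum>u\<in>choices p s. of_bool (?D u (2 * (k + j) - 2)))) =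
      (\<Sum>j=2..s. (q - 1) * (q ^ (s - 1) - q ^ (j - 2) +
        2 * q ^ (j - 2) * of_bool (l < (p - 1) div 2 * power_sum p k (s - j))))"
    unfolding q_def using assms by (intro sum.cong refl sum_even_descents) auto
  also have "\<dots> = (\<Sum>e=0..n. (q - 1) * (q ^ (s - 1) + q ^ e - 2 * (q ^ e * ?I e)))"
  proof (rule sum.reindex_bij_witness[of _ "\<lambda>e. e + 2" "\<lambda>j. j - 2"])
    fix j assume "j \<in> {2..s}"
    then have "n - (j - 2) = s - j" by (auto simp: n)
    then show "(q - 1) * (q ^ (s - 1) + q ^ (j - 2) - 2 * (q ^ (j - 2) * ?I (j - 2))) =
        (q - 1) * (q ^ (s - 1) - q ^ (j - 2) +
        2 * q ^ (j - 2) * of_bool (l < (p - 1) div 2 * power_sum p k (s - j)))"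
      by (simp add: not_less[symmetric])
  qed (auto simp: n)
  also have "(\<Sum>j=2..<s. 2 * (\<Sum>u\<in>choices p s. of_bool (?D u (2 * (k + j) - 1)))) =
      (\<Sum>j=2..<s. (q - 1) * (q ^ (s - 1) - q ^ (j - 1) +
        2 * q ^ (j - 2) * int (threshold_count p k l (s - 1 - j))))"
    unfolding q_def using assms by (intro sum.cong refl sum_odd_descents) auto
  also have "\<dots> = (\<Sum>e<n. (q - 1) * (q ^ (s - 1) - q ^ Suc e + 2 * (q ^ e * ?T e)))"
  proof (rule sum.reindex_bij_witness[of _ "\<lambda>e. e + 2" "\<lambda>j. j - 2"])
    fix j assume "j \<in> {2..<s}"
    then have "n - 1 - (j - 2) = s - 1 - j" "j - 1 = Suc (j - 2)" by (auto simp: n)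
    then show "(q - 1) * (q ^ (s - 1) - q ^ Suc (j - 2) + 2 * (q ^ (j - 2) * ?T (j - 2))) =
        (q - 1) * (q ^ (s - 1) - q ^ (j - 1) +
        2 * q ^ (j - 2) * int (threshold_count p k l (s - 1 - j)))"
      by simp
  qed (auto simp: n)
  also have "(q - 1) * q ^ (s - 1) + (\<Sum>e=0..n. (q - 1) * (q ^ (s - 1) + q ^ e - 2 * (q ^ e * ?I e))) +
      (\<Sum>e<n. (q - 1) * (q ^ (s - 1) - q ^ Suc e + 2 * (q ^ e * ?T e))) =
      (q - 1) * (2 * (int s - 1) * q ^ (s - 1) + 1 - 2 * (\<Sum>e=0..n. q ^ e * ?I e)
        + 2 * (\<Sum>e<n. q ^ e * ?T e))"
  proof -
    \<comment> \<open>The terms \<open>q ^ e\<close> of the even blocks cancel the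
      \<open>- q ^ Suc e\<close> of the odd blocks up to the summand 1.\<close>
    have "(\<Sum>e=0..n. q ^ e) = 1 + (\<Sum>e<n. q ^ Suc e)"
      by (simp add: atLeast0AtMost sum.atMost_shift)
    then show ?thesis
      unfolding sum_distrib_left[symmetric]
      by (simp add: sum.distrib sum_subtractf n algebra_simps flip: sum_distrib_left)
  qed
  finally have "2 * int (fibonacci_number p k s l) = 2 * (int h * (2 * (int s - 1) * q ^ (s - 1) + 1
        - 2 * (\<Sum>e=0..n. q ^ e * ?I e) + 2 * (\<Sum>e<n. q ^ e * ?T e)))"
    by (simp add: q_def h)
  moreover have "(int p - 1) div 2 = int h" by (simp add: h)
  ultimately show ?thesis by (simp add: q_def n)
qed

subsection \<open>Ordering of the thresholds\<close>

lemma power_sum_antimono: "m \<le> m' \<Longrightarrow> power_sum p k m' \<le> power_sum p k m"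
  unfolding power_sum_def by (rule sum_mono2) auto

lemma power_sum_pos: "1 \<le> p \<Longrightarrow> m < k \<Longrightarrow> 0 < power_sum p k m"
  unfolding power_sum_def by (rule sum_pos) auto

text \<open>Multiplying by \<open>p - 1\<close> turns the thresholds into closed forms that are easy to compare.\<close>

lemma threshold_scaled:
  assumes "v < p" "m \<le> k"
  shows "(p - 1) * threshold p k m v = v * p ^ k + (p - 1 - v) * p ^ m"
proof -
  have "(p - 1) * threshold p k m v + v * p ^ m =
      v * ((p - 1) * power_sum p k m + p ^ m) + (p - 1) * p ^ m"
    by (simp add: threshold_def algebra_simps)
  also have "(p - 1) * power_sum p k m + p ^ m = p ^ k" using assms by (intro power_sum_eq) auto
  also have "(p - 1) * p ^ m = (p - 1 - v) * p ^ m + v * p ^ m"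
    unfolding distrib_right[symmetric] using assms by simp
  finally show ?thesis by simp
qed

text \<open>As \<open>m\<close> grows, \<open>power_sum\<close> falls while \<open>p ^ m\<close>
  rises. The scaled form has the nonnegative coefficient \<open>p - 1 - v\<close> at
  \<open>p ^ m\<close> and settles the competition; for \<open>p = 1\<close> scaling would erase
  everything.\<close>

lemma threshold_mono:
  assumes "v < p" "m \<le> m'" "m' \<le> k"
  shows "threshold p k m v \<le> threshold p k m' v"
proof (cases "p = 1")
  case True
  then show ?thesis using assms power_sum_antimono[of m m'] by (simp add: threshold_def)
next
  case False
  have "p ^ m \<le> p ^ m'" using assms by (intro power_increasing) auto
  then have "(p - 1) * threshold p k m v \<le> (p - 1) * threshold p k m' v"
    unfolding threshold_scaled[OF assms(1) le_trans[OF assms(2,3)]] threshold_scaled[OF assms(1,3)]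
    by simp
  then show ?thesis using False assms(1) by simp
qed

text \<open>After scaling, raising \<open>v\<close> gains \<open>p ^ k\<close>, which is at least
  \<open>p ^ Suc m\<close> and outweighs the term with \<open>p ^ m\<close>. With
  \<open>threshold_mono\<close> this yields the lexicographic order.\<close>

lemma threshold_le_next:
  assumes "Suc v < p" "m < k" "m' \<le> k"
  shows "threshold p k m v \<le> threshold p k m' (Suc v)"
proof -
  have "p ^ Suc m \<le> p ^ k" using assms by (intro power_increasing) auto
  moreover have "(p - 1 - v) * p ^ m \<le> p * p ^ m" by (intro mult_right_mono) auto
  moreover have "(p - 1) * threshold p k m v = v * p ^ k + (p - 1 - v) * p ^ m"
    "(p - 1) * threshold p k m' (Suc v) = v * p ^ k + p ^ k + (p - 1 - Suc v) * p ^ m'"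
    using threshold_scaled[of v p m k] threshold_scaled[of "Suc v" p m' k] assms by simp_all
  ultimately have "(p - 1) * threshold p k m v \<le> (p - 1) * threshold p k m' (Suc v)"
    unfolding power_Suc by linarith
  then show ?thesis using assms(1) by simp
qed

lemma threshold_count_eqI:
  assumes "t \<le> p" "t = 0 \<or> threshold p k m (t - 1) \<le> l" "l < threshold p k m t"
  shows "threshold_count p k l m = t"
proof -
  have mono: "threshold p k m v \<le> threshold p k m w" if "v \<le> w" for v w
    using that by (simp add: threshold_def)
  have "{v. v < p \<and> threshold p k m v \<le> l} = {..<t}"
  proof (intro equalityI subsetI)
    fix v assume "v \<in> {v. v < p \<and> threshold p k m v \<le> l}"
    then show "v \<in> {..<t}" using assms(3) mono[of t v] by fastforce
  next
    fix v assume "v \<in> {..<t}"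
    then show "v \<in> {v. v < p \<and> threshold p k m v \<le> l}"
      using assms(1,2) mono[of v "t - 1"] by fastforce
  qed
  then show ?thesis by (simp add: threshold_count_def)
qed

text \<open>In lexicographic order \<open>l\<close> has reached the pair \<open>(t - 1, i)\<close>
  but not \<open>(t - 1, Suc i)\<close>. Hence all smaller digit values count, and
  \<open>t - 1\<close> itself counts only for \<open>m \<le> i\<close>.\<close>

lemma threshold_count_between:
  assumes "1 \<le> t" "t < p" "Suc i < k" "m < k"
    and "threshold p k i (t - 1) \<le> l" "l < threshold p k (Suc i) (t - 1)"
  shows "threshold_count p k l m = (if m \<le> i then t else t - 1)"
proof (cases "m \<le> i")
  case True
  have "threshold p k m (t - 1) \<le> l"
    using threshold_mono[of "t - 1" p m i k] assms True by linarith
  moreover have "l < threshold p k m t"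
    using threshold_le_next[of "t - 1" p "Suc i" k m] assms by simp
  ultimately show ?thesis using threshold_count_eqI[of t p k m l] assms True by simp
next
  case False
  have "t - 1 = 0 \<or> threshold p k m (t - 1 - 1) \<le> l"
  proof (cases "t = 1")
    case False
    then have "threshold p k m (t - 1 - 1) \<le> threshold p k i (Suc (t - 1 - 1))"
      using assms by (intro threshold_le_next) auto
    moreover have "Suc (t - 1 - 1) = t - 1" using False assms(1) by simp
    ultimately show ?thesis using assms(5) by (simp only:) linarith
  qed simp
  moreover have "threshold p k (Suc i) (t - 1) \<le> threshold p k m (t - 1)"
    using assms False by (intro threshold_mono) auto
  then have "l < threshold p k m (t - 1)" using assms(6) by linarith
  ultimately show ?thesis using threshold_count_eqI[of "t - 1" p k m l] assms False by simp
qed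

lemma threshold_count_above:
  assumes "1 \<le> t" "t < p" "i < k" "m \<le> i"
    and "threshold p k i (t - 1) \<le> l" "l < threshold p k 0 t"
  shows "threshold_count p k l m = t"
proof (rule threshold_count_eqI)
  have "threshold p k m (t - 1) \<le> l"
    using threshold_mono[of "t - 1" p m i k] assms by linarith
  then show "t = 0 \<or> threshold p k m (t - 1) \<le> l" ..
  show "l < threshold p k m t"
    using threshold_mono[of t p 0 m k] assms by simp
qed (use assms in simp)

section \<open>The two weighted sums on the intervals\<close>

lemma sum_threshold_count_between:
  assumes "1 \<le> t" "t < p" "n < k" "Suc i < n"
    and "threshold p k i (t - 1) \<le> l" "l < threshold p k (Suc i) (t - 1)"
  shows "(\<Sum>e<n. q ^ e * int (threshold_count p k l (n - 1 - e))) =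
    int t * (\<Sum>e<n. q ^ e) - (\<Sum>e<n - 1 - i. q ^ e)"
proof -
  have "(\<Sum>e<n. q ^ e * int (threshold_count p k l (n - 1 - e))) =
      (\<Sum>e<n. int t * q ^ e - (if e < n - 1 - i then q ^ e else 0))"
  proof (intro sum.cong refl)
    fix e assume "e \<in> {..<n}"
    \<comment> \<open>The indices \<open>m = n - 1 - e\<close> above \<open>i\<close> miss one
      threshold; they are the lowest exponents \<open>e\<close> and form the subtracted geometric
      sum.\<close>
    then have "n - 1 - e \<le> i \<longleftrightarrow> \<not> e < n - 1 - i" by auto
    then show "q ^ e * int (threshold_count p k l (n - 1 - e)) =
        int t * q ^ e - (if e < n - 1 - i then q ^ e else 0)"
      using threshold_count_between[of t p i k "n - 1 - e" l] assms
      by (simp add: of_nat_diff algebra_simps)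
  qed
  also have "\<dots> = int t * (\<Sum>e<n. q ^ e) - (\<Sum>e<n. if e < n - 1 - i then q ^ e else 0)"
    by (simp add: sum_subtractf sum_distrib_left)
  also have "(\<Sum>e<n. if e < n - 1 - i then q ^ e else 0) = (\<Sum>e<n - 1 - i. q ^ e)"
    by (intro sum.mono_neutral_cong_right) auto
  finally show ?thesis .
qed

lemma sum_threshold_count_above:
  assumes "1 \<le> t" "t < p" "n \<le> k" "1 \<le> n"
    and "threshold p k (n - 1) (t - 1) \<le> l" "l < threshold p k 0 t"
  shows "(\<Sum>e<n. q ^ e * int (threshold_count p k l (n - 1 - e))) = int t * (\<Sum>e<n. q ^ e)"
proof -
  have "threshold_count p k l (n - 1 - e) = t" for e
    using threshold_count_above[of t p "n - 1" k "n - 1 - e" l] assms by simp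
  then show ?thesis by (simp add: sum_distrib_left mult.commute)
qed

text \<open>Since \<open>power_sum\<close> falls with \<open>m\<close>, the indicators hold from
  some \<open>i\<close> on. The guarded assumptions admit the extremes \<open>i = 0\<close>, where
  all hold, and \<open>i = Suc n\<close>, where none does.\<close>

lemma sum_indicators:
  fixes q :: int
  assumes "i \<le> Suc n" "i \<le> n \<Longrightarrow> h * power_sum p k i \<le> l"
    and "0 < i \<Longrightarrow> l < h * power_sum p k (i - 1)"
  shows "(\<Sum>e=0..n. q ^ e * of_bool (h * power_sum p k (n - e) \<le> l)) = (\<Sum>e<Suc n - i. q ^ e)"
proof -
  have "h * power_sum p k m \<le> l \<longleftrightarrow> i \<le> m" if "m \<le> n" for m
  proof
    assume a: "h * power_sum p k m \<le> l"
    show "i \<le> m"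
    proof (rule ccontr)
      assume b: "\<not> i \<le> m"
      then have "h * power_sum p k (i - 1) \<le> h * power_sum p k m"
        by (intro mult_le_mono2 power_sum_antimono) simp
      then show False using a b assms(3) by linarith
    qed
  next
    assume a: "i \<le> m"
    then have "h * power_sum p k m \<le> h * power_sum p k i"
      by (intro mult_le_mono2 power_sum_antimono)
    then show "h * power_sum p k m \<le> l" using a that assms(2) by linarith
  qed
  then have "(\<Sum>e=0..n. q ^ e * of_bool (h * power_sum p k (n - e) \<le> l)) =
      (\<Sum>e=0..n. if e < Suc n - i then q ^ e else 0)"
    by (intro sum.cong refl) auto
  also have "\<dots> = (\<Sum>e<Suc n - i. q ^ e)"
    by (intro sum.mono_neutral_cong_right) auto
  finally show ?thesis .
qed

text \<open>Places the thresholds with \<open>v = h - 1\<close> below the half-thresholds. After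
  scaling it suffices that \<open>(h + 1) * p ^ n + h * p ^ Suc n\<close> is at most
  \<open>p ^ k\<close>.\<close>

lemma threshold_le_half:
  assumes "p = 2 * h + 1" "1 \<le> h" "Suc n < k"
  shows "threshold p k n (h - 1) \<le> h * power_sum p k (Suc n)"
proof -
  have "(p - 1) * threshold p k n (h - 1) = (h - 1) * p ^ k + (h + 1) * p ^ n"
    using assms by (subst threshold_scaled) auto
  moreover have "(p - 1) * (h * power_sum p k (Suc n)) + h * p ^ Suc n = h * p ^ k"
    using arg_cong[OF power_sum_eq[of p "Suc n" k], of "\<lambda>x. h * x"] assms
    by (simp add: algebra_simps)
  moreover have "h * p ^ k = (h - 1) * p ^ k + p ^ k" using assms(2) by (cases h) auto
  moreover have "(h + 1) * p ^ n \<le> p * p ^ n" using assms by (intro mult_right_mono) auto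
  moreover have "p ^ Suc (Suc n) \<le> p ^ k" using assms by (intro power_increasing) auto
  moreover have "p ^ Suc (Suc n) = 2 * (h * p ^ Suc n) + p ^ Suc n"
    using assms(1) by (simp only: power_Suc[of p "Suc n"]) (simp add: algebra_simps)
  ultimately have "(p - 1) * threshold p k n (h - 1) \<le> (p - 1) * (h * power_sum p k (Suc n))"
    by simp
  then show ?thesis using assms by simp
qed

text \<open>For \<open>t < h\<close> the end \<open>t * power_sum p k 0\<close> of an interval lies
  below every half-threshold. Strictness comes from the subtracted \<open>t\<close> after scaling,
  so \<open>t = 0\<close> needs its own argument.\<close>

lemma threshold_le_half':
  assumes "p = 2 * h + 1" "t < h" "m < k"
  shows "t * power_sum p k 0 + 1 \<le> h * power_sum p k m"
proof (cases "t = 0")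
  case True
  then show ?thesis using power_sum_pos[of p m k] assms by (simp add: Suc_le_eq)
next
  case False
  have "(p - 1) * (t * power_sum p k 0) + t = t * p ^ k"
    using arg_cong[OF power_sum_eq[of p 0 k], of "\<lambda>x. t * x"] assms
    by (simp add: algebra_simps)
  moreover have "(p - 1) * (h * power_sum p k m) + h * p ^ m = h * p ^ k"
    using arg_cong[OF power_sum_eq[of p m k], of "\<lambda>x. h * x"] assms
    by (simp add: algebra_simps)
  moreover have "(t + 1) * p ^ k \<le> h * p ^ k" using assms by (intro mult_right_mono) auto
  moreover have "h * p ^ m \<le> p * p ^ m" using assms by (intro mult_right_mono) auto
  moreover have "p ^ Suc m \<le> p ^ k" using assms by (intro power_increasing) auto
  ultimately have "(p - 1) * (t * power_sum p k 0) < (p - 1) * (h * power_sum p k m)"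
    using False unfolding power_Suc distrib_right mult_1 by linarith
  then show ?thesis using assms by simp
qed

section \<open>The case distinction\<close>

theorem theorem26:
  fixes p k s l :: nat
  assumes "prime p" and "odd p" and "2 \<le> k" and "3 \<le> s" and "s < k + 2" and "l < p ^ k"
  defines "M \<equiv> int (fibonacci_number p k s l)"
      and "h \<equiv> (int p - 1) div 2"
      and "q \<equiv> int p"
  shows
    "(l = 0 \<longrightarrow> M = h * (2 * (int s - 1) * q ^ (s - 1) + 1)) \<and>
     (\<forall>t. 1 \<le> t \<and> t \<le> (p - 3) div 2 \<longrightarrow>
        (\<forall>i. s \<noteq> 3 \<and> i \<le> s - 4 \<and>
           (t - 1) * (\<Sum>\<iota>=i..k-1. p ^ \<iota>) + p ^ i \<le> l \<and>
           l \<le> (t - 1) * (\<Sum>\<iota>=i+1..k-1. p ^ \<iota>) + p ^ (i + 1) - 1 \<longrightarrow>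
           M = h * (2 * (int s - 1) * q ^ (s - 1) + 1 + 2 * int t * (\<Sum>j=0..s-3. q ^ j)
                    - 2 * (\<Sum>\<mu>=0..s-i-4. q ^ \<mu>))) \<and>
        ((t - 1) * (\<Sum>\<iota>=s-3..k-1. p ^ \<iota>) + p ^ (s - 3) \<le> l \<and>
         l \<le> t * (\<Sum>\<iota>=0..k-1. p ^ \<iota>) \<longrightarrow>
           M = h * (2 * (int s - 1) * q ^ (s - 1) + 1 + 2 * int t * (\<Sum>j=0..s-3. q ^ j)))) \<and>
     (\<forall>i. s \<noteq> 3 \<and> i \<le> s - 4 \<and>
        (p - 3) div 2 * (\<Sum>\<iota>=i..k-1. p ^ \<iota>) + p ^ i \<le> l \<and>
        l \<le> (p - 3) div 2 * (\<Sum>\<iota>=i+1..k-1. p ^ \<iota>) + p ^ (i + 1) - 1 \<longrightarrow>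
        M = h * (2 * (int s - 1) * q ^ (s - 1) + 1 + (q - 1) * (\<Sum>j=0..s-3. q ^ j)
                 - 2 * (\<Sum>\<mu>=0..s-i-4. q ^ \<mu>))) \<and>
     ((p - 3) div 2 * (\<Sum>\<iota>=s-3..k-1. p ^ \<iota>) + p ^ (s - 3) \<le> l \<and>
      l \<le> (p - 1) div 2 * (\<Sum>\<iota>=s-2..k-1. p ^ \<iota>) - 1 \<longrightarrow>
        M = h * (2 * (int s - 1) * q ^ (s - 1) + 1 + q ^ (s - 2) - 1)) \<and>
     (\<forall>i'. 1 \<le> i' \<and> i' \<le> s - 2 \<and>
        (p - 1) div 2 * (\<Sum>\<iota>=i'..k-1. p ^ \<iota>) \<le> l \<and>
        l \<le> (p - 1) div 2 * (\<Sum>\<iota>=i'-1..k-1. p ^ \<iota>) - 1 \<longrightarrow>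
        M = h * (2 * (int s - 1) * q ^ (s - 1) - 1 - q ^ (s - 2) - 2 * (\<Sum>\<theta>=1..s-3. q ^ \<theta>)
                 + 2 * (\<Sum>\<mu>=s-i'-1..s-2. q ^ \<mu>) - 1)) \<and>
     (l = (p - 1) div 2 * (\<Sum>\<iota>=0..k-1. p ^ \<iota>) \<longrightarrow>
        M = h * (2 * (int s - 1) * q ^ (s - 1) - 1 - q ^ (s - 2) - 2 * (\<Sum>\<theta>=1..s-3. q ^ \<theta>) - 1)) \<and>
     (\<forall>t. (p + 1) div 2 \<le> t \<and> t \<le> p - 1 \<longrightarrow>
        (\<forall>i. s \<noteq> 3 \<and> i \<le> s - 4 \<and>
           (t - 1) * (\<Sum>\<iota>=i..k-1. p ^ \<iota>) + p ^ i \<le> l \<and>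
           l \<le> (t - 1) * (\<Sum>\<iota>=i+1..k-1. p ^ \<iota>) + p ^ (i + 1) - 1 \<longrightarrow>
           M = h * (2 * (int s - 1) * q ^ (s - 1) - 1 + (2 * int t - 2 * q) * (\<Sum>j=0..s-3. q ^ j)
                    - 2 * (\<Sum>\<mu>=0..s-i-4. q ^ \<mu>))) \<and>
        ((t - 1) * (\<Sum>\<iota>=s-3..k-1. p ^ \<iota>) + p ^ (s - 3) \<le> l \<and>
         l \<le> t * (\<Sum>\<iota>=0..k-1. p ^ \<iota>) \<longrightarrow>
           M = h * (2 * (int s - 1) * q ^ (s - 1) - 1 + (2 * int t - 2 * q) * (\<Sum>j=0..s-3. q ^ j))))"
proof -
  obtain c where c: "p = 2 * c + 1" using assms(2) by (auto elim: oddE)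
  have c1: "1 \<le> c" using assms(1) prime_gt_1_nat[of p] by (simp add: c)
  have cs: "(p - 3) div 2 = c - 1" "(p - 1) div 2 = c" "(p + 1) div 2 = c + 1" "p - 1 = 2 * c"
    by (auto simp: c)
  obtain n where n: "s = n + 2" "1 \<le> n" using assms(4) 
    by (intro that[of "s - 2"]) simp_all
  have s2: "s - 2 = n" using n by simp
  have nk: "n < k" using assms(5) by (simp add: n)
  have sum_eq: "(\<Sum>\<iota>=m..k-1. p ^ \<iota>) = power_sum p k m" for m
    unfolding power_sum_def using assms(3) by (intro sum.cong) auto
  have geo_eq: "(\<Sum>e=0..b. q ^ e) = (\<Sum>e<Suc b. q ^ e)" for b
    by (intro sum.cong) auto
  \<comment> \<open>Every case reduces to the values of \<open>V\<close> and \<open>W\<close>; the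
    rest is arithmetic with the geometric sum \<open>S\<close>.\<close>
  define V where "V = (\<Sum>e<n. q ^ e * int (threshold_count p k l (n - 1 - e)))"
  define W where "W = (\<Sum>e=0..n. q ^ e * of_bool (c * power_sum p k (n - e) \<le> l))"
  define S where "S = (\<Sum>e<n. q ^ e)"
  define G where "G = 2 * (int s - 1) * q ^ (s - 1)"
  have M: "M = h * (G + 1 - 2 * W + 2 * V)"
    using fibonacci_number_eq[of p s k l] assms(2,5,6) c1 n
    by (simp add: M_def h_def G_def W_def V_def q_def cs c)
  have S: "(q - 1) * S = q ^ n - 1" unfolding S_def by (rule power_diff_1_eq[symmetric])
  have q: "q - 1 = 2 * int c" by (simp add: q_def c)
  have W_low: "W = 0" if "l < c * power_sum p k n"
    using sum_indicators[of "Suc n" n c p k l q] that by (simp add: W_def)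
  have W_full: "W = S + q ^ n" if "c * power_sum p k 0 \<le> l"
    using sum_indicators[of 0 n c p k l q] that by (simp add: W_def S_def)
  have geo_iii: "(\<Sum>\<mu>=s-i-1..s-2. q ^ \<mu>) = S + q ^ n - (\<Sum>e<Suc n - i. q ^ e)" for i
  proof -
    have "(\<Sum>e=0..<Suc n - i. q ^ e) + (\<Sum>e=Suc n - i..<Suc n. q ^ e) = (\<Sum>e=0..<Suc n. q ^ e)"
      by (rule sum.atLeastLessThan_concat) simp_all
    moreover have "{s-i-1..s-2} = {Suc n - i..<Suc n}" by (auto simp: n)
    ultimately show ?thesis by (simp add: S_def atLeast0LessThan)
  qed
  have geo_tail: "(\<Sum>\<theta>=1..s-3. q ^ \<theta>) = S - 1"
  proof -
    have "{..<n} = insert 0 {1..s-3}" using n by auto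
    then show ?thesis by (simp add: S_def)
  qed
  \<comment> \<open>For \<open>c < t\<close> even the largest half-threshold
    \<open>c * power_sum p k 0\<close> is at most the smallest threshold of \<open>t - 1\<close>, so
    all indicators hold.\<close>
  have above_half: "W = S + q ^ n" if "c < t" "threshold p k m (t - 1) \<le> l" "t < p" "m < k" for t m
  proof (rule W_full)
    have "c * power_sum p k 0 \<le> (t - 1) * power_sum p k 0"
      using that by (intro mult_le_mono1) simp
    also have "\<dots> \<le> threshold p k 0 (t - 1)" by (simp add: threshold_def)
    also have "\<dots> \<le> threshold p k m (t - 1)" using that by (intro threshold_mono) auto
    finally show "c * power_sum p k 0 \<le> l" using that by simp
  qed
  have between: "V = int t * S - (\<Sum>e=0..s-i-4. q ^ e)" "W = (if t \<le> c then 0 else S + q ^ n)"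
    if t: "1 \<le> t" "t < p" and i: "s \<noteq> 3" "i \<le> s - 4"
      and lower: "(t - 1) * power_sum p k i + p ^ i \<le> l"
      and upper: "l \<le> (t - 1) * power_sum p k (i + 1) + p ^ (i + 1) - 1" for t i
  proof -
    have in': "Suc i < n" "Suc (s - i - 4) = n - 1 - i" using i n by auto
    have lower': "threshold p k i (t - 1) \<le> l" using lower by (simp add: threshold_def)
    have "0 < p ^ (i + 1)" using t by simp
    then have upper': "l < threshold p k (Suc i) (t - 1)"
      using upper unfolding threshold_def Suc_eq_plus1 by linarith
    show "V = int t * S - (\<Sum>e=0..s-i-4. q ^ e)"
      unfolding V_def S_def geo_eq in'(2)
      by (rule sum_threshold_count_between[OF t nk in'(1) lower' upper'])
    show "W = (if t \<le> c then 0 else S + q ^ n)"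
    proof (cases "t \<le> c")
      case True
      have "threshold p k (Suc i) (t - 1) \<le> threshold p k (n - 1) (t - 1)"
        using in' nk t by (intro threshold_mono) auto
      also have "\<dots> \<le> threshold p k (n - 1) (c - 1)"
        using True by (auto simp: threshold_def)
      also have "\<dots> \<le> c * power_sum p k n"
        using threshold_le_half[OF c c1, of "n - 1" k] nk n by simp
      finally show ?thesis using W_low upper' True by simp
    next
      case False
      then show ?thesis using above_half[of t i] lower' t in' nk by simp
    qed
  qed
  have V_above: "V = int t * S"
    if t: "1 \<le> t" "t < p" and lower: "threshold p k (n - 1) (t - 1) \<le> l"
      and upper: "l \<le> t * power_sum p k 0" for t
    unfolding V_def S_def using that n nk
    by (intro sum_threshold_count_above) (auto simp: threshold_def)
  \<comment> \<open>For \<open>t = c\<close> the half-thresholds fall inside the interval and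
    \<open>W\<close> varies; this is why (c) splits further.\<close>
  have above: "V = int t * S" "t \<noteq> c \<Longrightarrow> W = (if t \<le> c then 0 else S + q ^ n)"
    if t: "1 \<le> t" "t < p" and lower: "(t - 1) * power_sum p k (s - 3) + p ^ (s - 3) \<le> l"
      and upper: "l \<le> t * power_sum p k 0" for t
  proof -
    have lower': "threshold p k (n - 1) (t - 1) \<le> l" using lower n by (simp add: threshold_def)
    show "V = int t * S" by (rule V_above[OF t lower' upper])
    show "W = (if t \<le> c then 0 else S + q ^ n)" if "t \<noteq> c"
    proof (cases "t \<le> c")
      case True
      then show ?thesis using threshold_le_half'[OF c, of t n k] nk upper that W_low by simp
    next
      case False
      then show ?thesis using above_half[OF _ lower'] t nk by simp
    qed
  qed
  have half: "V = int c * S"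
    if "threshold p k (n - 1) (c - 1) \<le> l" "l \<le> c * power_sum p k 0"
    using that V_above[of c] c c1 by simp
  have half': "V = int c * S" if "c * power_sum p k m \<le> l" "m \<le> n" "l \<le> c * power_sum p k 0" for m
  proof (rule half[OF _ that(3)])
    have "threshold p k (n - 1) (c - 1) \<le> c * power_sum p k n"
      using threshold_le_half[OF c c1, of "n - 1" k] nk n by simp
    also have "\<dots> \<le> c * power_sum p k m"
      using that by (intro mult_le_mono2 power_sum_antimono)
    finally show "threshold p k (n - 1) (c - 1) \<le> l" using that by simp
  qed
  have case_a: "M = h * (G + 1)" if "l = 0"
  proof -
    have "V = 0" unfolding V_def threshold_count_def threshold_def that using c by simp
    moreover have "W = 0" using W_low that c1 power_sum_pos[of p n k] nk c by simp
    ultimately show ?thesis using M by simp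
  qed
  have low: "M = h * (G + 1 + 2 * int t * S - 2 * U)" if "V = int t * S - U" "W = 0" for t U
    unfolding M that by (simp add: algebra_simps)
  \<comment> \<open>With all indicators equal to 1, the identity
    \<open>q * S = S + q ^ n - 1\<close> turns \<open>1 - 2 * W\<close> into
    \<open>- 1 - 2 * q * S\<close>.\<close>
  have high: "M = h * (G - 1 + (2 * int t - 2 * q) * S - 2 * U)"
    if "V = int t * S - U" "W = S + q ^ n" for t U
  proof -
    have "q * S = S + q ^ n - 1" using S by (simp add: algebra_simps)
    then have "G + 1 - 2 * (S + q ^ n) + 2 * (int t * S - U) =
        G - 1 + (2 * int t - 2 * q) * S - 2 * U" by (simp add: algebra_simps)
    then show ?thesis unfolding M that by simp
  qed
  have S_exp: "(\<Sum>e=0..s-3. q ^ e) = S"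
  proof -
    have "Suc (s - 3) = n" using n by simp
    then show ?thesis by (simp only: geo_eq S_def)
  qed
  \<comment> \<open>Here \<open>2 * int c * S = q ^ n - 1\<close> turns \<open>V\<close> into a
    power of \<open>q\<close>. The term \<open>S + q ^ n - U\<close> is the weight of the indicators
    that fail; it vanishes in (iv).\<close>
  have mid: "M = h * (G - 1 - q ^ (s - 2) - 2 * (S - 1) + 2 * (S + q ^ n - U) - 1)"
    if "V = int c * S" "W = U" for U
  proof -
    have "2 * int c * S = q ^ n - 1" using S q by simp
    then show ?thesis unfolding M that by (simp add: n algebra_simps)
  qed
  have cii: "M = h * (G + 1 + q ^ (s - 2) - 1)" if "V = int c * S" "W = 0"
  proof -
    have "2 * int c * S = q ^ n - 1" using S q by simp
    then show ?thesis unfolding M that by (simp add: n algebra_simps)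
  qed
  have pos: "0 < c * power_sum p k m" if "m < k" for m
    using power_sum_pos[of p m k] that c1 by (simp add: c)
  show ?thesis
    unfolding sum_eq S_exp G_def[symmetric] geo_tail geo_iii cs(1-3)
  proof (intro conjI allI impI; (elim conjE)?)
    assume "l = 0"
    then show "M = h * (G + 1)" by (rule case_a)
  next
    fix t i
    assume "1 \<le> t" "t \<le> c - 1" "s \<noteq> 3" "i \<le> s - 4"
      "(t - 1) * power_sum p k i + p ^ i \<le> l"
      "l \<le> (t - 1) * power_sum p k (i + 1) + p ^ (i + 1) - 1"
    then show "M = h * (G + 1 + 2 * int t * S - 2 * (\<Sum>\<mu>=0..s-i-4. q ^ \<mu>))"
      using low between[of t i] c by simp
  next
    fix t
    assume "1 \<le> t" "t \<le> c - 1" "(t - 1) * power_sum p k (s - 3) + p ^ (s - 3) \<le> l"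
      "l \<le> t * power_sum p k 0"
    then show "M = h * (G + 1 + 2 * int t * S)"
      using low[of t 0] above[of t] c by simp
  next
    fix i
    assume "s \<noteq> 3" "i \<le> s - 4" "(c - 1) * power_sum p k i + p ^ i \<le> l"
      "l \<le> (c - 1) * power_sum p k (i + 1) + p ^ (i + 1) - 1"
    then show "M = h * (G + 1 + (q - 1) * S - 2 * (\<Sum>\<mu>=0..s-i-4. q ^ \<mu>))"
      using low between[of c i] c c1 q by simp
  next
    assume l: "(c - 1) * power_sum p k (s - 3) + p ^ (s - 3) \<le> l"
      "l \<le> c * power_sum p k (s - 2) - 1"
    have less: "l < c * power_sum p k n" using l(2) pos[OF nk] unfolding s2 by linarith
    moreover have "c * power_sum p k n \<le> c * power_sum p k 0"
      by (intro mult_le_mono2 power_sum_antimono) simp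
    ultimately have "l \<le> c * power_sum p k 0" by linarith
    moreover have "threshold p k (n - 1) (c - 1) \<le> l" using l(1) n by (simp add: threshold_def)
    ultimately show "M = h * (G + 1 + q ^ (s - 2) - 1)" using less by (intro cii half W_low)
  next
    fix i
    assume i: "1 \<le> i" "i \<le> s - 2"
      and l: "c * power_sum p k i \<le> l" "l \<le> c * power_sum p k (i - 1) - 1"
    have "i - 1 < k" using i nk n by simp
    from pos[OF this] have less: "l < c * power_sum p k (i - 1)" using l(2) by linarith
    moreover have "c * power_sum p k (i - 1) \<le> c * power_sum p k 0"
      by (intro mult_le_mono2 power_sum_antimono) simp
    ultimately have "l \<le> c * power_sum p k 0" by linarith
    then have "V = int c * S" using half'[of i] l(1) i n by simp
    moreover have "W = (\<Sum>e<Suc n - i. q ^ e)"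
      unfolding W_def using i n l(1) less by (intro sum_indicators) auto
    ultimately show "M = h * (G - 1 - q ^ (s - 2) - 2 * (S - 1)
        + 2 * (S + q ^ n - (\<Sum>e<Suc n - i. q ^ e)) - 1)" by (rule mid)
  next
    assume l: "l = c * power_sum p k 0"
    have "V = int c * S" using half'[of 0] l by simp
    moreover have "W = S + q ^ n" using W_full l by simp
    ultimately show "M = h * (G - 1 - q ^ (s - 2) - 2 * (S - 1) - 1)"
      using mid by simp
  next
    fix t i
    assume "c + 1 \<le> t" "t \<le> p - 1" "s \<noteq> 3" "i \<le> s - 4"
      "(t - 1) * power_sum p k i + p ^ i \<le> l"
      "l \<le> (t - 1) * power_sum p k (i + 1) + p ^ (i + 1) - 1"
    then show "M = h * (G - 1 + (2 * int t - 2 * q) * S - 2 * (\<Sum>\<mu>=0..s-i-4. q ^ \<mu>))"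
      using high between[of t i] c by simp
  next
    fix t
    assume "c + 1 \<le> t" "t \<le> p - 1" "(t - 1) * power_sum p k (s - 3) + p ^ (s - 3) \<le> l"
      "l \<le> t * power_sum p k 0"
    then show "M = h * (G - 1 + (2 * int t - 2 * q) * S)"
      using high[of t 0] above[of t] c by simp
  qed
qed

end
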